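(* Let $n\geq2$ and let $1\leq s\leq n/2$ be an integer. Put $$ Z_{n,s}=\sqrt{s+2}\,B_2^s\times\sqrt{n-s+2}\,B_2^{n-s},\qquad K_{n,s}=|Z_{n,s}|^{-1/n}Z_{n,s}. $$ Then $K_{n,s}$ is symmetric and isotropic, and $$ r(K_{n,s})\simeq\sqrt s,\qquad b(K_{n,s})\simeq\frac1{\sqrt s},\qquad M(K_{n,s})\simeq\frac1{\sqrt n}. $$ Consequently, for every $m\geq1$ and every $U_1,\ldots,U_m\in O(n)$, $$ d_{\rm G}\left(\frac1m\sum_{j=1}^mU_j^*(K_{n,s}^\circ),B_2^n\right)\geq c\max\left\{1,\sqrt{\frac{n}{sm}}\right\}. $$ If $m\geq k_0$ and the rotations $U_1,\ldots,U_m$ are independent and Haar-distributed on $O(n)$, then, with probability at least $1-e^{-cn}$, $$ d_{\rm G}\left(\frac1m\sum_{j=1}^mU_j^*(K_{n,s}^\circ),B_2^n\right)\simeq\max\left\{1,\sqrt{\frac{n}{sm}}\right\}. $$ In particular, the threshold $m\simeq n/r(K)^2$ in the global averaging estimate (G) recalled in the context is optimal, up to absolute constants, throughout the possible range of the inradius.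
   Context: $|\cdot|$ of a set is Lebesgue measure, $B_2^d$ is the Euclidean unit ball of $\mathbb{R}^d$, $S^{n-1}$ is the Euclidean unit sphere of $\mathbb{R}^n$ and $O(n)$ is the orthogonal group. A convex body $K\subseteq\mathbb{R}^n$ (compact convex set with nonempty interior) is isotropic if $|K|=1$, its barycenter is the origin and there is $L_K>0$ with $\int_K\langle x,\theta\rangle^2\,dx=L_K^2$ for all $\theta\in S^{n-1}$; it is symmetric if $K=-K$. For $K$ with the origin in its interior, $p_K(x)=\inf\{t>0:x\in tK\}$, $M(K)=\int_{S^{n-1}}p_K\,d\sigma$ with $\sigma$ the rotationally invariant probability measure on $S^{n-1}$, $b(K)=\max_{S^{n-1}}p_K$, and $r(K)=\max\{r>0:rB_2^n\subseteq K\}$ is the inradius. $K^\circ=\{x:\langle x,y\rangle\leq1\ \text{for all }y\in K\}$ is the polar body, $U^*$ is the adjoint of $U$, and sums of sets are Minkowski sums. The geometric distance of symmetric convex bodies is $d_{\rm G}(K,L)=\inf\{ab:a^{-1}L\subseteq K\subseteq bL,\ a,b>0\}$. The symbols $c,C$ denote positive absolute constants whose values may change from one occurrence to the next, and $a\simeq b$ means $c_1a\leq b\leq C_1a$ for absolute constants $c_1,C_1>0$. Global averaging estimate (G): there exist an absolute integer $k_0\geq2$ and absolute constants $c,C>0$ such that, for every symmetric isotropic convex body $K\subseteq\mathbb{R}^n$ and every integer $k\geq k_0$, independent Haar-distributed $U_1,\ldots,U_k\in O(n)$ satisfy $$ d_{\rm G}\left(\frac1k\sum_{i=1}^kU_i^*(K^\circ),B_2^n\right)\leq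 C\max\left\{1,\frac1{r(K)}\sqrt{\frac nk}\right\} $$ with probability at least $1-e^{-cn}$. The integer $k_0$ in the claim is the one from this estimate. The estimate gives bounded geometric distance as soon as $k\geq k_0$ and $k\geq Cn/r(K)^2$; this is the threshold meant in the claim. Every symmetric isotropic convex body in $\mathbb{R}^n$ satisfies $c\leq r(K)\leq C\sqrt n$, which is the possible range of the inradius. *)

theory Defs
  imports "HOL-Probability.Probability"
begin

(* The constants in the theorem are absolute, so the dimension n has to be bound inside
   formulas and cannot be a type. A vector of R^n is an extensional function on {..<n}; thus
   R^n is both topspace (powertop_real {..<n}) and the space of the product of n copies of
   lborel. An n x n matrix is an extensional function on {..<n} x {..<n}. *)

type_synonym rvec = "nat \<Rightarrow> real"
type_synonym rmat = "nat \<times> nat \<Rightarrow> real"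

definition Rn :: "nat \<Rightarrow> rvec set" where
  "Rn n = {..<n} \<rightarrow>\<^sub>E UNIV"

definition lebesgue_Rn :: "nat \<Rightarrow> rvec measure" where
  "lebesgue_Rn n = Pi\<^sub>M {..<n} (\<lambda>_. lborel)"

definition vol :: "nat \<Rightarrow> rvec set \<Rightarrow> real" where
  "vol n A = measure (lebesgue_Rn n) A"

definition vscale :: "nat \<Rightarrow> real \<Rightarrow> rvec \<Rightarrow> rvec" where
  "vscale n t x = (\<lambda>i\<in>{..<n}. t * x i)"

definition vadd :: "nat \<Rightarrow> rvec \<Rightarrow> rvec \<Rightarrow> rvec" where
  "vadd n x y = (\<lambda>i\<in>{..<n}. x i + y i)"

definition dot :: "nat \<Rightarrow> rvec \<Rightarrow> rvec \<Rightarrow> real" where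
  "dot n x y = (\<Sum>i<n. x i * y i)"

definition dilate :: "nat \<Rightarrow> real \<Rightarrow> rvec set \<Rightarrow> rvec set" where
  "dilate n t A = vscale n t ` A"

definition unit_ball :: "nat \<Rightarrow> rvec set" where
  "unit_ball n = {x \<in> Rn n. sqrt (dot n x x) \<le> 1}"

definition unit_sphere :: "nat \<Rightarrow> rvec set" where
  "unit_sphere n = {x \<in> Rn n. sqrt (dot n x x) = 1}"


definition convex_body :: "nat \<Rightarrow> rvec set \<Rightarrow> bool" where
  "convex_body n K \<longleftrightarrow>
     compactin (powertop_real {..<n}) K \<and>
     (\<forall>x\<in>K. \<forall>y\<in>K. \<forall>u\<ge>0. \<forall>v\<ge>0. u + v = 1 \<longrightarrow> vadd n (vscale n u x) (vscale n v y) \<in> K) \<and>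
     powertop_real {..<n} interior_of K \<noteq> {}"

definition barycenter :: "nat \<Rightarrow> rvec set \<Rightarrow> rvec" where
  "barycenter n K = (\<lambda>i\<in>{..<n}. (LINT x:K|lebesgue_Rn n. x i) / vol n K)"

definition isotropic :: "nat \<Rightarrow> rvec set \<Rightarrow> bool" where
  "isotropic n K \<longleftrightarrow>
     convex_body n K \<and> vol n K = 1 \<and> barycenter n K = (\<lambda>i\<in>{..<n}. 0) \<and>
     (\<exists>L>0. \<forall>\<theta>\<in>unit_sphere n. (LINT x:K|lebesgue_Rn n. (dot n x \<theta>)\<^sup>2) = L\<^sup>2)"

definition symmetric :: "nat \<Rightarrow> rvec set \<Rightarrow> bool" where
  "symmetric n K \<longleftrightarrow> K = dilate n (-1) K"

definition gauge :: "nat \<Rightarrow> rvec set \<Rightarrow> rvec \<Rightarrow> real" where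
  "gauge n K x = Inf {t. 0 < t \<and> x \<in> dilate n t K}"

definition inradius :: "nat \<Rightarrow> rvec set \<Rightarrow> real" where
  "inradius n K = Sup {r. 0 < r \<and> dilate n r (unit_ball n) \<subseteq> K}"

definition gauge_max :: "nat \<Rightarrow> rvec set \<Rightarrow> real" where
  "gauge_max n K = (SUP x\<in>unit_sphere n. gauge n K x)"

definition polar :: "nat \<Rightarrow> rvec set \<Rightarrow> rvec set" where
  "polar n K = {x \<in> Rn n. \<forall>y\<in>K. dot n x y \<le> 1}"

definition geom_dist :: "nat \<Rightarrow> rvec set \<Rightarrow> rvec set \<Rightarrow> real" where
  "geom_dist n K L =
     Inf {a * b | a b. 0 < a \<and> 0 < b \<and> dilate n (1 / a) L \<subseteq> K \<and> K \<subseteq> dilate n b L}"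


definition mat_apply :: "nat \<Rightarrow> rmat \<Rightarrow> rvec \<Rightarrow> rvec" where
  "mat_apply n U x = (\<lambda>i\<in>{..<n}. \<Sum>j<n. U (i, j) * x j)"

definition mat_mult :: "nat \<Rightarrow> rmat \<Rightarrow> rmat \<Rightarrow> rmat" where
  "mat_mult n U V = (\<lambda>(i, j)\<in>{..<n} \<times> {..<n}. \<Sum>k<n. U (i, k) * V (k, j))"

definition adjoint_mat :: "nat \<Rightarrow> rmat \<Rightarrow> rmat" where
  "adjoint_mat n U = (\<lambda>(i, j)\<in>{..<n} \<times> {..<n}. U (j, i))"

definition orthogonal_group :: "nat \<Rightarrow> rmat set" where
  "orthogonal_group n =
     {U \<in> {..<n} \<times> {..<n} \<rightarrow>\<^sub>E UNIV.
        mat_mult n (adjoint_mat n U) U =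
          (\<lambda>(i, j)\<in>{..<n} \<times> {..<n}. if i = j then 1 else 0)}"

(* Haar measure on O(n), and the rotation invariant probability measure on the sphere, are
   the unique measures with the following properties; statements involving them are
   quantified over all measures with these properties. On a compact group a left invariant
   probability measure is automatically right invariant. *)

definition haar_orthogonal :: "nat \<Rightarrow> rmat measure \<Rightarrow> bool" where
  "haar_orthogonal n \<mu> \<longleftrightarrow>
     prob_space \<mu> \<and> space \<mu> = orthogonal_group n \<and>
     sets \<mu> = sets (restrict_space (Pi\<^sub>M ({..<n} \<times> {..<n}) (\<lambda>_. borel)) (orthogonal_group n)) \<and>
     (\<forall>V\<in>orthogonal_group n. distr \<mu> \<mu> (mat_mult n V) = \<mu>)"

definition sphere_measure :: "nat \<Rightarrow> rvec measure \<Rightarrow> bool" where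
  "sphere_measure n \<sigma> \<longleftrightarrow>
     prob_space \<sigma> \<and> space \<sigma> = unit_sphere n \<and>
     sets \<sigma> = sets (restrict_space (Pi\<^sub>M {..<n} (\<lambda>_. borel)) (unit_sphere n)) \<and>
     (\<forall>U\<in>orthogonal_group n. distr \<sigma> \<sigma> (mat_apply n U) = \<sigma>)"

definition gauge_mean :: "nat \<Rightarrow> rvec measure \<Rightarrow> rvec set \<Rightarrow> real" where
  "gauge_mean n \<sigma> K = (LINT x|\<sigma>. gauge n K x)"

definition minkowski_sum :: "nat \<Rightarrow> nat set \<Rightarrow> (nat \<Rightarrow> rvec set) \<Rightarrow> rvec set" where
  "minkowski_sum n J A = {(\<lambda>i\<in>{..<n}. \<Sum>j\<in>J. x j i) | x. \<forall>j\<in>J. x j \<in> A j}"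

definition polar_average :: "nat \<Rightarrow> nat \<Rightarrow> (nat \<Rightarrow> rmat) \<Rightarrow> rvec set \<Rightarrow> rvec set" where
  "polar_average n m U K =
     dilate n (1 / real m)
       (minkowski_sum n {1..m} (\<lambda>j. mat_apply n (adjoint_mat n (U j)) ` polar n K))"

(* "P holds with probability at least p": P holds on some event of probability at least p.
   This does not presuppose that {w. P w} itself is measurable. *)

definition holds_with_prob :: "'a measure \<Rightarrow> real \<Rightarrow> ('a \<Rightarrow> bool) \<Rightarrow> bool" where
  "holds_with_prob M p P \<longleftrightarrow> (\<exists>E\<in>sets M. p \<le> measure M E \<and> (\<forall>\<omega>\<in>E. P \<omega>))"

(* The joint law of k independent Haar distributed rotations is the k-fold product measure. *)

abbreviation haar_power :: "nat \<Rightarrow> rmat measure \<Rightarrow> (nat \<Rightarrow> rmat) measure" where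
  "haar_power k \<mu> \<equiv> Pi\<^sub>M {1..k} (\<lambda>_. \<mu>)"

(* "k0 is an integer for which the global averaging estimate holds", with absolute constants
   c and C. *)

definition global_averaging_estimate :: "nat \<Rightarrow> bool" where
  "global_averaging_estimate k0 \<longleftrightarrow>
     2 \<le> k0 \<and>
     (\<exists>c>0. \<exists>C>0. \<forall>n\<ge>1. \<forall>K. isotropic n K \<and> symmetric n K \<longrightarrow>
        (\<forall>k\<ge>k0. \<forall>\<mu>. haar_orthogonal n \<mu> \<longrightarrow>
           holds_with_prob (haar_power k \<mu>) (1 - exp (- c * real n))
             (\<lambda>U. geom_dist n (polar_average n k U K) (unit_ball n)
                    \<le> C * max 1 (1 / inradius n K * sqrt (real n / real k)))))"


(* The product of two Euclidean balls in R^s x R^(n-s), with R^s x R^(n-s) identified with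
   R^n through the first s and the last n - s coordinates. *)

definition Z_body :: "nat \<Rightarrow> nat \<Rightarrow> rvec set" where
  "Z_body n s =
     {x \<in> Rn n. sqrt (\<Sum>i\<in>{..<s}. (x i)\<^sup>2) \<le> sqrt (real s + 2) \<and>
                sqrt (\<Sum>i\<in>{s..<n}. (x i)\<^sup>2) \<le> sqrt (real (n - s) + 2)}"

definition K_body :: "nat \<Rightarrow> nat \<Rightarrow> rvec set" where
  "K_body n s = dilate n (vol n (Z_body n s) powr (- 1 / real n)) (Z_body n s)"

definition admissible :: "nat \<Rightarrow> nat \<Rightarrow> bool" where
  "admissible n s \<longleftrightarrow> 2 \<le> n \<and> 1 \<le> s \<and> real s \<le> real n / 2"

(* Optimality of the threshold k ~ n / r(K)^2 of the global averaging estimate throughout the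
   range c <= r(K) <= C sqrt n. Sufficiency: above a constant multiple of the threshold the
   distance is bounded with high probability, for every body. Necessity: every value rho in the range [a, A sqrt n],
   whatever the constants a and A, is up to constants the inradius of a body for which bounded
   distance for any choice at all of m rotations forces m to be at least a constant multiple of
   the threshold. The constant eta D depends only on a, A and the bound D. *)

definition threshold_sufficient :: "nat \<Rightarrow> bool" where
  "threshold_sufficient k0 \<longleftrightarrow>
     (\<exists>T>0. \<exists>D\<ge>1. \<exists>c>0. \<forall>n\<ge>1. \<forall>K. isotropic n K \<and> symmetric n K \<longrightarrow>
        (\<forall>k\<ge>k0. real k \<ge> T * (real n / (inradius n K)\<^sup>2) \<longrightarrow>
           (\<forall>\<mu>. haar_orthogonal n \<mu> \<longrightarrow>
              holds_with_prob (haar_power k \<mu>) (1 - exp (- c * real n))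
                (\<lambda>U. geom_dist n (polar_average n k U K) (unit_ball n) \<le> D))))"

definition threshold_necessary :: bool where
  "threshold_necessary \<longleftrightarrow>
     (\<forall>a>0. \<forall>A>0. \<exists>c>0. \<exists>C>0. \<exists>\<eta> :: real \<Rightarrow> real. (\<forall>D\<ge>1. \<eta> D > 0) \<and>
        (\<forall>n\<ge>2. \<forall>\<rho>. a \<le> \<rho> \<and> \<rho> \<le> A * sqrt (real n) \<longrightarrow>
           (\<exists>K. isotropic n K \<and> symmetric n K \<and>
                c * \<rho> \<le> inradius n K \<and> inradius n K \<le> C * \<rho> \<and>
                (\<forall>D\<ge>1. \<forall>m\<ge>1. \<forall>U. (\<forall>j\<in>{1..m}. U j \<in> orthogonal_group n) \<and>
                     geom_dist n (polar_average n m U K) (unit_ball n) \<le> D \<longrightarrow>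
                     real m \<ge> \<eta> D * (real n / (inradius n K)\<^sup>2)))))"

end

theory Submission imports Defs
begin

text \<open>Write \<open>\<bar>x\<bar>\<^sub>J\<close> for the Euclidean norm of the coordinates in \<open>J\<close>, and \<open>J = {..<s}\<close>.
  The body is \<open>K = {x. \<bar>x\<bar>\<^sub>J \<le> a, \<bar>x\<bar>\<^sub>J\<^sub>c \<le> b}\<close> with \<open>a = \<lambda> sqrt (s + 2)\<close> and
  \<open>b = \<lambda> sqrt (n - s + 2)\<close>; comparing the unnormalised body with a cube and with a Gaussian shows
  that \<open>\<lambda>\<close> is bounded above and below. The inradius is \<open>a\<close> and the gauge is
  \<open>max (\<bar>x\<bar>\<^sub>J / a) (\<bar>x\<bar>\<^sub>J\<^sub>c / b)\<close>.

  If \<open>\<alpha>\<^sup>-\<^sup>1 B \<subseteq> L \<subseteq> \<beta> B\<close> for the average \<open>L\<close> of the rotated polars, then \<open>L\<close> contains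
  \<open>(m a)\<^sup>-\<^sup>1 (\<epsilon>\<^sub>1 v\<^sub>1 + \<dots> + \<epsilon>\<^sub>m v\<^sub>m)\<close> for unit vectors \<open>v\<^sub>j\<close> and any signs, and suitable signs give
  \<open>\<beta> \<ge> 1 / (a sqrt m)\<close>. In the other direction the support function of \<open>L\<close>, averaged over the
  coordinate vectors, is at most \<open>sqrt (s / n) / a + 1 / b\<close>, which bounds \<open>\<alpha>\<^sup>-\<^sup>1\<close>.
  Multiplying gives the lower bound for the distance.\<close>

section \<open>Monomial changes of variables\<close>

text \<open>On a ball of radius \<open>R\<close> in dimension \<open>k\<close> each coordinate has
  mean square \<open>R\<^sup>2 / (k + 2)\<close>. Radii proportional to \<open>sqrt (k + 2)\<close>
  therefore give both blocks the same second moments, and the isotropic constant is \<lambda>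
  itself. Volumes enter through their \<open>n\<close>-th roots, so comparisons that lose a factor
  exponential in \<open>n\<close> still give absolute bounds for \<lambda>. It follows that
  \<open>a\<close> is of order \<open>sqrt s\<close> and \<open>b\<close> of order
  \<open>sqrt n\<close>. Both summands of \<open>sqrt (s / n) / a + 1 / b\<close> are then of order
  \<open>1 / sqrt n\<close>, and dividing \<open>1 / (a * sqrt m)\<close> by this gives
  \<open>sqrt (n / (s * m))\<close>. The unit vectors are the \<open>k\<close>-th rows of the
  rotations for one fixed \<open>k\<close> in \<open>J\<close>, that is, the images of the
  \<open>k\<close>-th coordinate vector under the adjoints. This lower bound holds for every choice
  of rotations; probability enters only in the upper bound, through (G) with inradius
  \<open>a\<close>. The dimension is a variable and not a type, so Lebesgue measure is a product
  measure on functions. All moments and volumes are obtained from monomial matrices alone, since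
  these pull boxes back to boxes.\<close>

interpretation lborel_product: product_sigma_finite "\<lambda>_::nat. lborel :: real measure"
  by standard

lemma space_lebesgue_Rn [simp]: "space (lebesgue_Rn n) = Rn n"
  by (auto simp: lebesgue_Rn_def Rn_def space_PiM)

lemma measurable_lebesgue_Rn_component [measurable]:
  "i < n \<Longrightarrow> (\<lambda>x. x i) \<in> borel_measurable (lebesgue_Rn n)"
  by (simp add: lebesgue_Rn_def)

text \<open>One format for the three kinds of substitution that occur: scaling of the two blocks,
  reflection of a coordinate, and transposition of two coordinates.\<close>

definition monomial_map :: "nat \<Rightarrow> (nat \<Rightarrow> real) \<Rightarrow> (nat \<Rightarrow> nat) \<Rightarrow> rvec \<Rightarrow> rvec" where
  "monomial_map n c p x = (\<lambda>i\<in>{..<n}. c i * x (p i))"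

lemma measurable_monomial_map:
  assumes "p permutes {..<n}"
  shows "monomial_map n c p \<in> measurable (lebesgue_Rn n) (lebesgue_Rn n)"
proof -
  have "(\<lambda>x. \<lambda>i\<in>{..<n}. c i * x (p i)) \<in> measurable (Pi\<^sub>M {..<n} (\<lambda>_. lborel)) (Pi\<^sub>M {..<n} (\<lambda>_. lborel))"
  proof (rule measurable_restrict)
    fix i assume "i \<in> {..<n}"
    then have "p i \<in> {..<n}"
      using assms permutes_in_image by metis
    then have "(\<lambda>x. x (p i)) \<in> measurable (Pi\<^sub>M {..<n} (\<lambda>_. lborel :: real measure)) lborel"
      by (rule measurable_component_singleton)
    then show "(\<lambda>x. c i * x (p i)) \<in> measurable (Pi\<^sub>M {..<n} (\<lambda>_. lborel)) lborel"
      by simp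
  qed
  then show ?thesis
    unfolding monomial_map_def lebesgue_Rn_def .
qed

text \<open>A product measure is determined by its values on boxes, and the preimage of a box is a
  box, so the determinant formula reduces to scaling on the line. Putting the determinant into a
  density of the image measure avoids dividing by it.\<close>

lemma lebesgue_Rn_monomial_map:
  assumes p: "p permutes {..<n}" and c: "\<And>i. i < n \<Longrightarrow> c i \<noteq> 0"
  shows "density (distr (lebesgue_Rn n) (lebesgue_Rn n) (monomial_map n c p))
           (\<lambda>_. ennreal (\<Prod>i<n. \<bar>c i\<bar>)) = lebesgue_Rn n" (is "?D = _")
  unfolding lebesgue_Rn_def[of n]
proof (rule lborel_product.PiM_eqI)
  fix A assume A: "\<And>i. i \<in> {..<n} \<Longrightarrow> A i \<in> sets (lborel :: real measure)"
  have inv: "inv p permutes {..<n}"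
    using p by (rule permutes_inv)
  have im: "p ` {..<n} = {..<n}" "inv p ` {..<n} = {..<n}"
    using p inv by (auto simp: permutes_image)
  define B where "B = (\<lambda>i. (\<lambda>t. c (inv p i) * t) -` A (inv p i))"
  have B: "B i \<in> sets lborel" if "i < n" for i
  proof -
    have "inv p i \<in> {..<n}" using im that by blast
    from A[OF this] have "A (inv p i) \<in> sets borel" by simp
    then have "(\<lambda>t. c (inv p i) * t) -` A (inv p i) \<inter> space borel \<in> sets borel"
      by (rule measurable_sets[rotated]) simp
    then show ?thesis by (simp add: B_def)
  qed
  have pre: "monomial_map n c p -` Pi\<^sub>E {..<n} A \<inter> space (lebesgue_Rn n) = Pi\<^sub>E {..<n} B"
  proof (intro equalityI subsetI)
    fix x assume x: "x \<in> monomial_map n c p -` Pi\<^sub>E {..<n} A \<inter> space (lebesgue_Rn n)"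
    have "x k \<in> B k" if "k < n" for k
    proof -
      have k: "inv p k \<in> {..<n}" using im that by blast
      then have "monomial_map n c p x (inv p k) \<in> A (inv p k)" using x by auto
      then show ?thesis
        using k p by (simp add: B_def monomial_map_def permutes_inverses)
    qed
    then show "x \<in> Pi\<^sub>E {..<n} B" using x by (auto simp: Rn_def PiE_def)
  next
    fix x assume x: "x \<in> Pi\<^sub>E {..<n} B"
    have "c i * x (p i) \<in> A i" if "i < n" for i
    proof -
      have "p i \<in> {..<n}" using im that by blast
      then have "x (p i) \<in> B (p i)" using x by auto
      then show ?thesis using p by (simp add: B_def permutes_inverses)
    qed
    then show "x \<in> monomial_map n c p -` Pi\<^sub>E {..<n} A \<inter> space (lebesgue_Rn n)"
      using x by (auto simp: Rn_def PiE_def monomial_map_def)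
  qed
  have box: "Pi\<^sub>E {..<n} A \<in> sets (lebesgue_Rn n)"
    using A by (simp add: lebesgue_Rn_def sets_PiM_I_finite)
  have scale: "emeasure lborel (A i) = ennreal \<bar>c i\<bar> * emeasure lborel (B (p i))" if "i < n" for i
  proof -
    have Ai [measurable]: "A i \<in> sets borel" using A that by simp
    have "emeasure lborel (A i) = (\<integral>\<^sup>+t. indicator (A i) t \<partial>lborel)"
      by simp
    also have "\<dots> = ennreal \<bar>c i\<bar> * (\<integral>\<^sup>+t. indicator (A i) (0 + c i * t) \<partial>lborel)"
      by (rule nn_integral_real_affine) (use c that in auto)
    also have "(\<integral>\<^sup>+t. indicator (A i) (0 + c i * t) \<partial>lborel) = (\<integral>\<^sup>+t. indicator (B (p i)) t \<partial>lborel)"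
      using p by (intro nn_integral_cong) (auto simp: B_def permutes_inverses indicator_def)
    also have "\<dots> = emeasure lborel (B (p i))"
      using B[of "p i"] im that by (intro nn_integral_indicator) auto
    finally show ?thesis .
  qed
  have "emeasure ?D (Pi\<^sub>E {..<n} A) = ennreal (\<Prod>i<n. \<bar>c i\<bar>) * emeasure (lebesgue_Rn n) (Pi\<^sub>E {..<n} B)"
    using box p by (simp add: emeasure_density_const emeasure_distr measurable_monomial_map pre[simplified])
  also have "emeasure (lebesgue_Rn n) (Pi\<^sub>E {..<n} B) = (\<Prod>i<n. emeasure lborel (B i))"
    unfolding lebesgue_Rn_def using B by (intro lborel_product.emeasure_PiM) auto
  also have "\<dots> = (\<Prod>i<n. emeasure lborel (B (p i)))"
    using p by (subst prod.permute[OF p]) (simp add: comp_def)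
  also have "ennreal (\<Prod>i<n. \<bar>c i\<bar>) * (\<Prod>i<n. emeasure lborel (B (p i)))
      = (\<Prod>i<n. ennreal \<bar>c i\<bar>) * (\<Prod>i<n. emeasure lborel (B (p i)))"
    by (simp add: prod_ennreal)
  also have "\<dots> = (\<Prod>i<n. emeasure lborel (A i))"
    by (simp add: prod.distrib[symmetric] scale cong: prod.cong_simp)
  finally show "emeasure (density
           (distr (Pi\<^sub>M {..<n} (\<lambda>_. lborel)) (Pi\<^sub>M {..<n} (\<lambda>_. lborel)) (monomial_map n c p))
           (\<lambda>_. ennreal (\<Prod>i<n. \<bar>c i\<bar>))) (Pi\<^sub>E {..<n} A) =
         (\<Prod>i\<in>{..<n}. emeasure lborel (A i))"
    by (simp only: lebesgue_Rn_def)
qed simp_all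

lemma integral_monomial_map:
  fixes f :: "rvec \<Rightarrow> real"
  assumes "p permutes {..<n}" "\<And>i. i < n \<Longrightarrow> c i \<noteq> 0" and f: "f \<in> borel_measurable (lebesgue_Rn n)"
  shows "(LINT x|lebesgue_Rn n. f x)
    = (\<Prod>i<n. \<bar>c i\<bar>) * (LINT x|lebesgue_Rn n. f (monomial_map n c p x))"
proof -
  have "(LINT x|lebesgue_Rn n. f x) = (LINT x|density (distr (lebesgue_Rn n) (lebesgue_Rn n)
      (monomial_map n c p)) (\<lambda>_. ennreal (\<Prod>i<n. \<bar>c i\<bar>)). f x)"
    using lebesgue_Rn_monomial_map[OF assms(1,2)] by simp
  also have "\<dots> = (LINT x|distr (lebesgue_Rn n) (lebesgue_Rn n) (monomial_map n c p).
      (\<Prod>i<n. \<bar>c i\<bar>) * f x)"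
    using f by (subst integral_density) (auto simp: prod_nonneg)
  also have "\<dots> = (\<Prod>i<n. \<bar>c i\<bar>) * (LINT x|lebesgue_Rn n. f (monomial_map n c p x))"
    using f measurable_monomial_map[OF assms(1)] by (subst integral_distr) auto
  finally show ?thesis .
qed

section \<open>Products of two balls: measurability and boundedness\<close>

definition block_body :: "nat \<Rightarrow> nat set \<Rightarrow> real \<Rightarrow> real \<Rightarrow> rvec set" where
  "block_body n J a b = {x \<in> Rn n. L2_set x J \<le> a \<and> L2_set x ({..<n} - J) \<le> b}"

text \<open>The reason for an arbitrary index set \<open>J\<close> instead of an initial segment:
  results for the block \<open>J\<close> and radius \<open>a\<close> carry over to the complementary
  block and \<open>b\<close>.\<close>

lemma block_body_swap: "J \<subseteq> {..<n} \<Longrightarrow> block_body n ({..<n} - J) a b = block_body n J b a"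
  by (auto simp: block_body_def double_diff)

lemma measurable_L2_set [measurable]:
  "J \<subseteq> {..<n} \<Longrightarrow> (\<lambda>x. L2_set x J) \<in> borel_measurable (lebesgue_Rn n)"
  unfolding L2_set_def
proof -
  assume "J \<subseteq> {..<n}"
  then have "(\<lambda>x. \<Sum>i\<in>J. (x i)\<^sup>2) \<in> borel_measurable (lebesgue_Rn n)"
    by (intro borel_measurable_sum borel_measurable_power measurable_lebesgue_Rn_component) auto
  then show "(\<lambda>x. sqrt (\<Sum>i\<in>J. (x i)\<^sup>2)) \<in> borel_measurable (lebesgue_Rn n)"
    by measurable
qed

lemma sets_block_body [measurable]:
  assumes "J \<subseteq> {..<n}" shows "block_body n J a b \<in> sets (lebesgue_Rn n)"
proof -
  have [measurable]: "(\<lambda>x. L2_set x J) \<in> borel_measurable (lebesgue_Rn n)"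
    "(\<lambda>x. L2_set x ({..<n} - J)) \<in> borel_measurable (lebesgue_Rn n)"
    using assms by auto
  have "{x \<in> space (lebesgue_Rn n). L2_set x J \<le> a \<and> L2_set x ({..<n} - J) \<le> b} \<in> sets (lebesgue_Rn n)"
    by measurable
  then show ?thesis by (simp add: block_body_def)
qed

lemma abs_le_L2_set: "finite J \<Longrightarrow> i \<in> J \<Longrightarrow> \<bar>x i\<bar> \<le> L2_set x J"
  using member_le_L2_set[of J i "\<lambda>i. \<bar>x i\<bar>"] by (simp add: L2_set_def)

lemma block_body_coord_le:
  assumes "x \<in> block_body n J a b" "i < n" "J \<subseteq> {..<n}"
  shows "\<bar>x i\<bar> \<le> max a b"
proof (cases "i \<in> J")
  case True
  then show ?thesis using assms abs_le_L2_set[of J i x] finite_subset[OF assms(3)]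
    by (auto simp: block_body_def)
next
  case False
  then show ?thesis using assms abs_le_L2_set[of "{..<n} - J" i x]
    by (auto simp: block_body_def)
qed

lemma emeasure_block_body_finite:
  assumes J: "J \<subseteq> {..<n}"
  shows "emeasure (lebesgue_Rn n) (block_body n J a b) < \<infinity>"
proof -
  let ?B = "Pi\<^sub>E {..<n} (\<lambda>_. {- max a b .. max a b})"
  have "block_body n J a b \<subseteq> ?B"
  proof
    fix x assume x: "x \<in> block_body n J a b"
    then have "x i \<in> {- max a b .. max a b}" if "i < n" for i
      using block_body_coord_le[OF x that J] by (simp add: abs_le_iff)
    then show "x \<in> ?B" using x by (auto simp: block_body_def Rn_def PiE_def)
  qed
  moreover have "?B \<in> sets (lebesgue_Rn n)"
    by (simp add: lebesgue_Rn_def sets_PiM_I_finite)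
  ultimately have "emeasure (lebesgue_Rn n) (block_body n J a b) \<le> emeasure (lebesgue_Rn n) ?B"
    by (rule emeasure_mono)
  also have "\<dots> = (\<Prod>i<n. emeasure lborel {- max a b .. max a b})"
    unfolding lebesgue_Rn_def by (rule lborel_product.emeasure_PiM) auto
  also have "\<dots> < \<infinity>"
    by (simp add: emeasure_lborel_Icc_eq ennreal_power less_top[symmetric] zero_power)
  finally show ?thesis .
qed

lemma set_integrable_block_body:
  fixes f :: "rvec \<Rightarrow> real"
  assumes J: "J \<subseteq> {..<n}" and f: "f \<in> borel_measurable (lebesgue_Rn n)"
    and le: "\<And>x. x \<in> block_body n J a b \<Longrightarrow> \<bar>f x\<bar> \<le> C"
  shows "set_integrable (lebesgue_Rn n) (block_body n J a b) f"
  unfolding set_integrable_def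
proof (rule integrableI_bounded_set_indicator)
  show "AE x in lebesgue_Rn n. x \<in> block_body n J a b \<longrightarrow> norm (f x) \<le> C"
    using le by auto
qed (use J f emeasure_block_body_finite in auto)

lemma vol_eq_set_integral: "A \<subseteq> Rn n \<Longrightarrow> vol n A = (LINT x:A|lebesgue_Rn n. 1)"
  by (simp add: vol_def set_lebesgue_integral_def Int_absorb2)

section \<open>Second moments of products of balls\<close>

lemma monomial_map_in_Rn [simp]: "monomial_map n c p x \<in> Rn n"
  by (simp add: monomial_map_def Rn_def)

lemma L2_set_monomial_map_scale:
  assumes "J \<subseteq> {..<n}" "u \<ge> 0" "\<And>i. i \<in> J \<Longrightarrow> c i = u"
  shows "L2_set (monomial_map n c id x) J = u * L2_set x J"
proof -
  have "L2_set (monomial_map n c id x) J = L2_set (\<lambda>i. u * x i) J"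
    using assms by (intro L2_set_cong) (auto simp: monomial_map_def)
  then show ?thesis
    using assms by (simp add: L2_set_right_distrib)
qed

lemma monomial_map_in_block_body_iff:
  assumes "J \<subseteq> {..<n}" "u > 0" "v > 0" "x \<in> Rn n"
  shows "monomial_map n (\<lambda>i. if i \<in> J then u else v) id x \<in> block_body n J (u * a) (v * b)
    \<longleftrightarrow> x \<in> block_body n J a b"
  using assms L2_set_monomial_map_scale[of J n u "\<lambda>i. if i \<in> J then u else v" x]
    L2_set_monomial_map_scale[of "{..<n} - J" n v "\<lambda>i. if i \<in> J then u else v" x]
  by (simp add: block_body_def)

text \<open>Scaling by \<open>u\<close> on \<open>J\<close> and by \<open>v\<close> off
  \<open>J\<close> carries the body with radii \<open>a\<close>, \<open>b\<close> onto the one with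
  radii \<open>u * a\<close>, \<open>v * b\<close>; the power factors are the determinant.\<close>

lemma set_integral_block_body_scale:
  fixes g :: "rvec \<Rightarrow> real"
  assumes J: "J \<subseteq> {..<n}" and uv: "u > 0" "v > 0" and g: "g \<in> borel_measurable (lebesgue_Rn n)"
  shows "(LINT x:block_body n J (u * a) (v * b)|lebesgue_Rn n. g x) =
    u ^ card J * v ^ (n - card J) *
    (LINT x:block_body n J a b|lebesgue_Rn n. g (monomial_map n (\<lambda>i. if i \<in> J then u else v) id x))"
proof -
  let ?c = "\<lambda>i. if i \<in> J then u else v"
  have fin: "finite J" using J finite_subset by blast
  have "(\<Prod>i<n. \<bar>?c i\<bar>) = (\<Prod>i<n. ?c i)"
    using uv by (intro prod.cong) auto
  also have "\<dots> = (\<Prod>i\<in>J. u) * (\<Prod>i\<in>{..<n} - J. v)"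
    using J by (subst prod.If_cases) (auto simp: Int_absorb1 Diff_eq)
  also have "\<dots> = u ^ card J * v ^ (n - card J)"
    using J fin by (simp add: card_Diff_subset)
  finally have pr: "(\<Prod>i<n. \<bar>?c i\<bar>) = u ^ card J * v ^ (n - card J)" .
  have ind: "(\<lambda>x. indicator (block_body n J (u * a) (v * b)) x *\<^sub>R g x) \<in> borel_measurable (lebesgue_Rn n)"
    using g sets_block_body[OF J] by auto
  have "(LINT x:block_body n J (u * a) (v * b)|lebesgue_Rn n. g x) = (\<Prod>i<n. \<bar>?c i\<bar>) *
     (LINT x|lebesgue_Rn n. indicator (block_body n J (u * a) (v * b)) (monomial_map n ?c id x)
        *\<^sub>R g (monomial_map n ?c id x))"
    unfolding set_lebesgue_integral_def
    by (subst integral_monomial_map[OF permutes_id _ ind, where c = ?c]) (use uv in auto)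
  also have "(LINT x|lebesgue_Rn n. indicator (block_body n J (u * a) (v * b)) (monomial_map n ?c id x)
        *\<^sub>R g (monomial_map n ?c id x)) = (LINT x:block_body n J a b|lebesgue_Rn n. g (monomial_map n ?c id x))"
    unfolding set_lebesgue_integral_def using J uv
    by (intro Bochner_Integration.integral_cong) (auto simp: indicator_def monomial_map_in_block_body_iff)
  finally show ?thesis by (simp add: pr)
qed

lemma block_body_subset_Rn: "block_body n J a b \<subseteq> Rn n"
  by (auto simp: block_body_def)

lemma vol_block_body_scale:
  assumes "J \<subseteq> {..<n}" "u > 0" "v > 0"
  shows "vol n (block_body n J (u * a) (v * b)) = u ^ card J * v ^ (n - card J) * vol n (block_body n J a b)"
  using set_integral_block_body_scale[OF assms, of "\<lambda>_. 1"]
  by (simp add: vol_eq_set_integral block_body_subset_Rn)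

text \<open>Shrinking the radius \<open>a\<close> by a factor \<open>t\<close> multiplies the volume by \<open>t ^ card J\<close> and
  the second moment by \<open>t ^ (card J + 2)\<close>, while the integrand lies between \<open>(t a)\<^sup>2\<close> and \<open>a\<^sup>2\<close>
  on the removed shell. Letting \<open>t \<rightarrow> 1\<close> gives the value.\<close>

lemma block_second_moment:
  assumes J: "J \<subseteq> {..<n}" and ab: "a > 0" "b > 0"
  shows "(real (card J) + 2) * (LINT x:block_body n J a b|lebesgue_Rn n. (L2_set x J)\<^sup>2)
    = real (card J) * a\<^sup>2 * vol n (block_body n J a b)"
proof -
  let ?s = "card J"
  define F where "F = (\<lambda>t. LINT x:block_body n J (t * a) b|lebesgue_Rn n. (L2_set x J)\<^sup>2)"
  define G where "G = (\<lambda>t. vol n (block_body n J (t * a) b))"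
  have meas: "(\<lambda>x. (L2_set x J)\<^sup>2) \<in> borel_measurable (lebesgue_Rn n)"
    using measurable_L2_set[OF J] by measurable
  have intF: "set_integrable (lebesgue_Rn n) (block_body n J c b) (\<lambda>x. (L2_set x J)\<^sup>2)" for c
    by (rule set_integrable_block_body[OF J meas, of _ _ "c\<^sup>2"])
       (auto simp: block_body_def intro!: power_mono)
  have intG: "set_integrable (lebesgue_Rn n) (block_body n J c b) (\<lambda>x. 1 :: real)" for c
    by (rule set_integrable_block_body[OF J, of _ _ _ 1]) auto
  have Gint: "G t = (LINT x:block_body n J (t * a) b|lebesgue_Rn n. 1)" for t
    by (simp add: G_def vol_eq_set_integral block_body_subset_Rn)
  have Ft: "F t = t ^ (?s + 2) * F 1" if "t > 0" for t
  proof -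
    have "F t = t ^ ?s * (LINT x:block_body n J a b|lebesgue_Rn n.
        (L2_set (monomial_map n (\<lambda>i. if i \<in> J then t else 1) id x) J)\<^sup>2)"
      using set_integral_block_body_scale[OF J that zero_less_one meas, of a b] by (simp add: F_def)
    also have "\<dots> = t ^ ?s * (t\<^sup>2 * F 1)"
      using J that L2_set_monomial_map_scale[of J n t "\<lambda>i. if i \<in> J then t else 1"]
      by (simp add: F_def power_mult_distrib)
    finally show ?thesis by (simp add: power_add power2_eq_square)
  qed
  have Gt: "G t = t ^ ?s * G 1" if "t > 0" for t
    using vol_block_body_scale[OF J that zero_less_one, of a b] by (simp add: G_def)
  have shell: "t\<^sup>2 * a\<^sup>2 * (G 1 - G t) \<le> F 1 - F t" "F 1 - F t \<le> a\<^sup>2 * (G 1 - G t)"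
    if t: "0 < t" "t < 1" for t
  proof -
    \<comment> \<open>By the inclusion \<open>sub\<close>, \<open>?d\<close> is the indicator of the
      removed shell; off the shell both pointwise bounds read 0 on each side.\<close>
    let ?d = "\<lambda>x. indicator (block_body n J a b) x - indicator (block_body n J (t * a) b) x :: real"
    have sub: "block_body n J (t * a) b \<subseteq> block_body n J a b"
    proof -
      have "t * a \<le> a" using t ab by simp
      then show ?thesis by (auto simp: block_body_def)
    qed
    have dG: "integrable (lebesgue_Rn n) ?d"
      using intG[of a] intG[of "t * a"] by (simp add: set_integrable_def)
    have dF: "integrable (lebesgue_Rn n) (\<lambda>x. ?d x * (L2_set x J)\<^sup>2)"
      using intF[of a] intF[of "t * a"] by (simp add: set_integrable_def left_diff_distrib)
    have GG: "G 1 - G t = (LINT x|lebesgue_Rn n. ?d x)"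
      using intG[of a] intG[of "t * a"]
      by (simp add: Gint set_lebesgue_integral_def set_integrable_def)
    have FF: "F 1 - F t = (LINT x|lebesgue_Rn n. ?d x * (L2_set x J)\<^sup>2)"
      using intF[of a] intF[of "t * a"]
      by (simp add: F_def set_lebesgue_integral_def set_integrable_def left_diff_distrib)
    have lo: "t\<^sup>2 * a\<^sup>2 * ?d x \<le> ?d x * (L2_set x J)\<^sup>2" for x
    proof (cases "x \<in> block_body n J a b \<and> x \<notin> block_body n J (t * a) b")
      case True
      then have "t * a \<le> L2_set x J" by (auto simp: block_body_def)
      then have "(t * a)\<^sup>2 \<le> (L2_set x J)\<^sup>2" using t ab by (intro power_mono) auto
      then show ?thesis using True by (simp add: power_mult_distrib)
    qed (use sub in \<open>auto simp: indicator_def\<close>)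
    have hi: "?d x * (L2_set x J)\<^sup>2 \<le> a\<^sup>2 * ?d x" for x
    proof (cases "x \<in> block_body n J a b \<and> x \<notin> block_body n J (t * a) b")
      case True
      then have "L2_set x J \<le> a" by (auto simp: block_body_def)
      then have "(L2_set x J)\<^sup>2 \<le> a\<^sup>2" by (intro power_mono) auto
      then show ?thesis using True by simp
    qed (use sub in \<open>auto simp: indicator_def\<close>)
    show "t\<^sup>2 * a\<^sup>2 * (G 1 - G t) \<le> F 1 - F t"
      unfolding GG FF using dG dF lo
      by (subst integral_mult_right_zero[symmetric]) (intro integral_mono, auto)
    show "F 1 - F t \<le> a\<^sup>2 * (G 1 - G t)"
      unfolding GG FF using dG dF hi
      by (subst integral_mult_right_zero[symmetric]) (intro integral_mono, auto)
  qed
  \<comment> \<open>Both differences contain the factor \<open>1 - t\<close>. Cancelling it leaves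
    geometric sums with \<open>card J\<close> and \<open>card J + 2\<close> terms, whose limits at 1
    are these numbers; this takes the place of differentiating in the radius.\<close>
  have key: "t\<^sup>2 * a\<^sup>2 * ((\<Sum>i<?s. t ^ i) * G 1) \<le> (\<Sum>i<?s + 2. t ^ i) * F 1
      \<and> (\<Sum>i<?s + 2. t ^ i) * F 1 \<le> a\<^sup>2 * ((\<Sum>i<?s. t ^ i) * G 1)"
    if t: "0 < t" "t < 1" for t
  proof -
    have G1: "G 1 - G t = (1 - t) * ((\<Sum>i<?s. t ^ i) * G 1)"
    proof -
      have "G 1 - G t = (1 - t ^ ?s) * G 1"
        by (simp only: Gt[OF t(1)] left_diff_distrib mult_1)
      then show ?thesis by (simp only: one_diff_power_eq mult.assoc)
    qed
    have F1: "F 1 - F t = (1 - t) * ((\<Sum>i<?s + 2. t ^ i) * F 1)"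
    proof -
      have "F 1 - F t = (1 - t ^ (?s + 2)) * F 1"
        by (simp only: Ft[OF t(1)] left_diff_distrib mult_1)
      then show ?thesis by (simp only: one_diff_power_eq mult.assoc)
    qed
    have "(1 - t) * (t\<^sup>2 * a\<^sup>2 * ((\<Sum>i<?s. t ^ i) * G 1)) \<le> (1 - t) * ((\<Sum>i<?s + 2. t ^ i) * F 1)"
      "(1 - t) * ((\<Sum>i<?s + 2. t ^ i) * F 1) \<le> (1 - t) * (a\<^sup>2 * ((\<Sum>i<?s. t ^ i) * G 1))"
      using shell[OF t] by (simp_all only: G1 F1 ac_simps)
    then show ?thesis using t by (simp only: mult_le_cancel_left_pos diff_gt_0_iff_gt)
  qed
  have ev: "eventually (\<lambda>t::real. 0 < t \<and> t < 1) (at_left 1)"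
    using eventually_at_left_real[of 0 "1::real"] by (auto elim: eventually_mono)
  have lim: "((\<lambda>t. \<Sum>i<k. t ^ i) \<longlongrightarrow> real k) (at_left 1)" for k
  proof -
    have "((\<lambda>t::real. \<Sum>i<k. t ^ i) \<longlongrightarrow> (\<Sum>i<k. 1 ^ i)) (at_left 1)"
      by (intro tendsto_intros)
    then show ?thesis by simp
  qed
  have limF: "((\<lambda>t. (\<Sum>i<?s + 2. t ^ i) * F 1) \<longlongrightarrow> real (?s + 2) * F 1) (at_left 1)"
    by (intro tendsto_intros lim)
  have "((\<lambda>t. t\<^sup>2 * a\<^sup>2 * ((\<Sum>i<?s. t ^ i) * G 1)) \<longlongrightarrow> 1\<^sup>2 * a\<^sup>2 * (real ?s * G 1)) (at_left 1)"
    by (intro tendsto_intros lim)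
  then have le1: "1\<^sup>2 * a\<^sup>2 * (real ?s * G 1) \<le> real (?s + 2) * F 1"
    by (rule tendsto_le[OF trivial_limit_at_left_real limF]) (use ev key in \<open>auto elim!: eventually_mono\<close>)
  have "((\<lambda>t. a\<^sup>2 * ((\<Sum>i<?s. t ^ i) * G 1)) \<longlongrightarrow> a\<^sup>2 * (real ?s * G 1)) (at_left 1)"
    by (intro tendsto_intros lim)
  then have "real (?s + 2) * F 1 \<le> a\<^sup>2 * (real ?s * G 1)"
    by (rule tendsto_le[OF trivial_limit_at_left_real _ limF]) (use ev key in \<open>auto elim!: eventually_mono\<close>)
  with le1 have "real (?s + 2) * F 1 = a\<^sup>2 * (real ?s * G 1)"
    by simp
  then show ?thesis by (simp add: F_def G_def algebra_simps)
qed

text \<open>Signed permutations have determinant 1 in absolute value. Reflections will make odd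
  moments vanish, and transpositions will equate moments within a block.\<close>

lemma set_integral_monomial_map_invariant:
  fixes g :: "rvec \<Rightarrow> real"
  assumes p: "p permutes {..<n}" and c: "\<And>i. i < n \<Longrightarrow> \<bar>c i\<bar> = 1"
    and g: "g \<in> borel_measurable (lebesgue_Rn n)" and A: "A \<in> sets (lebesgue_Rn n)"
    and inv: "\<And>x. x \<in> Rn n \<Longrightarrow> monomial_map n c p x \<in> A \<longleftrightarrow> x \<in> A"
  shows "(LINT x:A|lebesgue_Rn n. g x) = (LINT x:A|lebesgue_Rn n. g (monomial_map n c p x))"
proof -
  have "c i \<noteq> 0" if "i < n" for i using c[OF that] by auto
  then have "(LINT x:A|lebesgue_Rn n. g x) = (\<Prod>i<n. \<bar>c i\<bar>) *
     (LINT x|lebesgue_Rn n. indicator A (monomial_map n c p x) *\<^sub>R g (monomial_map n c p x))"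
    unfolding set_lebesgue_integral_def using p g A
    by (subst integral_monomial_map[OF p, where c = c]) auto
  also have "(\<Prod>i<n. \<bar>c i\<bar>) = 1" using c by simp
  also have "(LINT x|lebesgue_Rn n. indicator A (monomial_map n c p x) *\<^sub>R g (monomial_map n c p x))
      = (LINT x:A|lebesgue_Rn n. g (monomial_map n c p x))"
    unfolding set_lebesgue_integral_def using inv
    by (intro Bochner_Integration.integral_cong) (auto simp: indicator_def)
  finally show ?thesis by simp
qed

lemma L2_set_monomial_map:
  assumes "p permutes J" "J \<subseteq> {..<n}" "\<And>i. i \<in> J \<Longrightarrow> \<bar>c i\<bar> = 1"
  shows "L2_set (monomial_map n c p x) J = L2_set x J"
proof -
  have "(\<Sum>i\<in>J. (monomial_map n c p x i)\<^sup>2) = (\<Sum>i\<in>J. (x (p i))\<^sup>2)"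
  proof (rule sum.cong)
    fix i assume i: "i \<in> J"
    have "(c i)\<^sup>2 = 1" using assms(3)[OF i] by (metis power2_abs power_one)
    then show "(monomial_map n c p x i)\<^sup>2 = (x (p i))\<^sup>2"
      using i assms(2) by (auto simp: monomial_map_def power_mult_distrib)
  qed simp
  also have "\<dots> = (\<Sum>i\<in>J. (x i)\<^sup>2)"
    using sum.permute[OF assms(1), of "\<lambda>i. (x i)\<^sup>2"] by (simp add: comp_def)
  finally show ?thesis by (simp add: L2_set_def)
qed

lemma block_body_reflect:
  assumes "J \<subseteq> {..<n}" "\<And>i. i < n \<Longrightarrow> \<bar>c i\<bar> = 1" "x \<in> Rn n"
  shows "monomial_map n c id x \<in> block_body n J a b \<longleftrightarrow> x \<in> block_body n J a b"
  using assms L2_set_monomial_map[of id J n c x] L2_set_monomial_map[of id "{..<n} - J" n c x]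
  by (auto simp: block_body_def permutes_id subset_iff)

lemma block_body_transpose:
  assumes J: "J \<subseteq> {..<n}" and ij: "i \<in> J" "j \<in> J" and x: "x \<in> Rn n"
  shows "monomial_map n (\<lambda>_. 1) (Transposition.transpose i j) x \<in> block_body n J a b
    \<longleftrightarrow> x \<in> block_body n J a b"
proof -
  let ?T = "monomial_map n (\<lambda>_. 1) (Transposition.transpose i j) x"
  have "L2_set ?T J = L2_set x J"
    using J ij by (intro L2_set_monomial_map permutes_swap_id) auto
  moreover have "L2_set ?T ({..<n} - J) = L2_set x ({..<n} - J)"
    using ij by (intro L2_set_cong) (auto simp: monomial_map_def Transposition.transpose_def)
  ultimately show ?thesis using x by (simp add: block_body_def)
qed

lemma measurable_coord_prod:
  "i < n \<Longrightarrow> j < n \<Longrightarrow> (\<lambda>x. x i * x j) \<in> borel_measurable (lebesgue_Rn n)"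
  by (intro borel_measurable_times measurable_lebesgue_Rn_component)

text \<open>Reflecting the coordinate \<open>i\<close> preserves the body and negates the integrand,
  so the integral equals its own negative.\<close>

lemma block_first_moment:
  assumes J: "J \<subseteq> {..<n}" and i: "i < n"
  shows "(LINT x:block_body n J a b|lebesgue_Rn n. x i) = 0"
proof -
  let ?c = "\<lambda>k. if k = i then -1 else 1 :: real"
  have "(LINT x:block_body n J a b|lebesgue_Rn n. x i)
      = (LINT x:block_body n J a b|lebesgue_Rn n. monomial_map n ?c id x i)"
    using J i by (intro set_integral_monomial_map_invariant)
      (auto simp: block_body_reflect permutes_id)
  also have "\<dots> = - (LINT x:block_body n J a b|lebesgue_Rn n. x i)"
    using i by (simp add: monomial_map_def set_lebesgue_integral_def)
  finally show ?thesis by simp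
qed

text \<open>The same reflection negates the product as well, because it leaves the other factor
  alone.\<close>

lemma block_mixed_moment:
  assumes J: "J \<subseteq> {..<n}" and i: "i < n" and j: "j < n" and ne: "i \<noteq> j"
  shows "(LINT x:block_body n J a b|lebesgue_Rn n. x i * x j) = 0"
proof -
  let ?c = "\<lambda>k. if k = i then -1 else 1 :: real"
  have "(LINT x:block_body n J a b|lebesgue_Rn n. x i * x j)
      = (LINT x:block_body n J a b|lebesgue_Rn n. monomial_map n ?c id x i * monomial_map n ?c id x j)"
    using J i j by (intro set_integral_monomial_map_invariant measurable_coord_prod)
      (auto simp: block_body_reflect permutes_id)
  also have "\<dots> = - (LINT x:block_body n J a b|lebesgue_Rn n. x i * x j)"
    using i j ne by (simp add: monomial_map_def set_lebesgue_integral_def)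
  finally show ?thesis by simp
qed

lemma set_integrable_coord_prod:
  assumes J: "J \<subseteq> {..<n}" and i: "i < n" and j: "j < n"
  shows "set_integrable (lebesgue_Rn n) (block_body n J a b) (\<lambda>x. x i * x j)"
proof (rule set_integrable_block_body[OF J measurable_coord_prod[OF i j]])
  fix x assume x: "x \<in> block_body n J a b"
  show "\<bar>x i * x j\<bar> \<le> max a b * max a b"
    using block_body_coord_le[OF x i J] block_body_coord_le[OF x j J]
    unfolding abs_mult by (intro mult_mono) auto
qed

text \<open>Transpositions inside \<open>J\<close> make the moments of its coordinates equal, so
  each is the fraction \<open>1 / card J\<close> of the block moment. For
  \<open>a = c * sqrt (card J + 2)\<close> and volume 1 the value is \<open>c\<^sup>2\<close>,
  whatever the size of the block.\<close>

lemma block_coord_second_moment: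
  assumes J: "J \<subseteq> {..<n}" and i: "i \<in> J" and ab: "a > 0" "b > 0"
  shows "(real (card J) + 2) * (LINT x:block_body n J a b|lebesgue_Rn n. x i * x i)
    = a\<^sup>2 * vol n (block_body n J a b)"
proof -
  have fin: "finite J" using J finite_subset by blast
  let ?I = "\<lambda>j. LINT x:block_body n J a b|lebesgue_Rn n. x j * x j"
  have eq: "?I j = ?I i" if j: "j \<in> J" for j
  proof -
    let ?p = "Transposition.transpose i j"
    have lt: "i < n" "j < n" using i j J by auto
    have "?I j = (LINT x:block_body n J a b|lebesgue_Rn n.
        monomial_map n (\<lambda>_. 1) ?p x j * monomial_map n (\<lambda>_. 1) ?p x j)"
      using J i j lt by (intro set_integral_monomial_map_invariant measurable_coord_prod permutes_swap_id)
        (auto simp: block_body_transpose)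
    also have "\<dots> = ?I i"
      using lt by (simp add: monomial_map_def)
    finally show ?thesis .
  qed
  have "(LINT x:block_body n J a b|lebesgue_Rn n. (L2_set x J)\<^sup>2)
      = (LINT x:block_body n J a b|lebesgue_Rn n. (\<Sum>j\<in>J. x j * x j))"
    by (simp add: L2_set_def sum_nonneg power2_eq_square)
  also have "\<dots> = (\<Sum>j\<in>J. ?I j)"
  proof -
    have "integrable (lebesgue_Rn n) (\<lambda>x. indicator (block_body n J a b) x * (x j * x j))" if "j \<in> J" for j
      using set_integrable_coord_prod[OF J, of j j a b] that J by (auto simp: set_integrable_def)
    then show ?thesis by (simp add: set_lebesgue_integral_def sum_distrib_left)
  qed
  also have "\<dots> = real (card J) * ?I i" using eq by simp
  finally have "real (card J) * ((real (card J) + 2) * ?I i)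
      = real (card J) * (a\<^sup>2 * vol n (block_body n J a b))"
    using block_second_moment[OF J ab] by (simp add: algebra_simps)
  moreover have "card J > 0" using fin i card_gt_0_iff by blast
  ultimately show ?thesis by simp
qed

section \<open>Volume, convexity and isotropy\<close>

text \<open>A point of the cube with sides \<open>{-1 .. 1}\<close> has norm at most
  \<open>sqrt k\<close> on any \<open>k\<close> coordinates, so this cube, of volume
  \<open>2 ^ n\<close>, lies in the body.\<close>

lemma vol_block_body_ge:
  assumes J: "J \<subseteq> {..<n}" and a: "real (card J) \<le> a\<^sup>2" "a > 0" and b: "real (n - card J) \<le> b\<^sup>2" "b > 0"
  shows "2 ^ n \<le> vol n (block_body n J a b)"
proof -
  have fin: "finite J" using J finite_subset by blast
  let ?B = "Pi\<^sub>E {..<n} (\<lambda>_. {-1 .. 1::real})"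
  have L2: "L2_set x I \<le> sqrt (real (card I))" if "x \<in> ?B" "I \<subseteq> {..<n}" for x I
  proof -
    have "(\<Sum>i\<in>I. (x i)\<^sup>2) \<le> (\<Sum>i\<in>I. 1)"
    proof (rule sum_mono)
      fix i assume "i \<in> I"
      then have "x i \<in> {-1..1}" using that by auto
      then have "\<bar>x i\<bar> \<le> 1" by (simp add: abs_le_iff)
      then show "(x i)\<^sup>2 \<le> 1" by (simp add: abs_square_le_1)
    qed
    then show ?thesis by (simp add: L2_set_def)
  qed
  have sub: "?B \<subseteq> block_body n J a b"
  proof
    fix x assume x: "x \<in> ?B"
    have "L2_set x J \<le> a"
      using L2[OF x J] a by (intro order_trans[OF L2[OF x J]]) (simp add: real_sqrt_le_iff real_le_lsqrt)
    moreover have "L2_set x ({..<n} - J) \<le> b"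
      using b J fin by (intro order_trans[OF L2[OF x Diff_subset]])
        (simp add: card_Diff_subset real_le_lsqrt)
    ultimately show "x \<in> block_body n J a b"
      using x by (auto simp: block_body_def Rn_def PiE_def)
  qed
  have "emeasure (lebesgue_Rn n) ?B = (\<Prod>i<n. emeasure lborel {-1..1::real})"
    unfolding lebesgue_Rn_def by (rule lborel_product.emeasure_PiM) auto
  also have "\<dots> = ennreal (2 ^ n)"
    using ennreal_power[of 2 n] by (simp add: emeasure_lborel_Icc_eq)
  finally have "2 ^ n = measure (lebesgue_Rn n) ?B"
    by (simp add: measure_def)
  also have "\<dots> \<le> vol n (block_body n J a b)"
  proof -
    have "?B \<in> sets (lebesgue_Rn n)"
      by (simp add: lebesgue_Rn_def sets_PiM_I_finite)
    then show ?thesis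
      unfolding vol_def using sub J emeasure_block_body_finite[OF J, of a b]
      by (intro measure_mono_fmeasurable) (auto simp: fmeasurable_def)
  qed
  finally show ?thesis .
qed

text \<open>On the body \<open>\<bar>x\<bar>\<^sup>2 \<le> a\<^sup>2 + b\<^sup>2\<close>, so its indicator is dominated by a multiple of the
  Gaussian density.\<close>

lemma vol_block_body_le:
  assumes J: "J \<subseteq> {..<n}" and a: "a \<ge> 0" and b: "b \<ge> 0"
  shows "vol n (block_body n J a b) \<le> exp ((a\<^sup>2 + b\<^sup>2) / 2) * sqrt (2 * pi) ^ n"
proof -
  let ?K = "block_body n J a b" and ?C = "exp ((a\<^sup>2 + b\<^sup>2) / 2) * sqrt (2 * pi) ^ n"
  have fin: "finite J" using J finite_subset by blast
  have pt: "indicator ?K x \<le> ennreal ?C * (\<Prod>i<n. ennreal (std_normal_density (x i)))" for x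
  proof (cases "x \<in> ?K")
    case True
    have "(\<Sum>i<n. (x i)\<^sup>2) = (\<Sum>i\<in>J. (x i)\<^sup>2) + (\<Sum>i\<in>{..<n} - J. (x i)\<^sup>2)"
      using J by (metis finite_lessThan sum.subset_diff add.commute)
    also have "\<dots> = (L2_set x J)\<^sup>2 + (L2_set x ({..<n} - J))\<^sup>2"
      by (simp add: L2_set_def sum_nonneg)
    also have "\<dots> \<le> a\<^sup>2 + b\<^sup>2"
      using True by (intro add_mono power_mono) (auto simp: block_body_def)
    finally have le: "(\<Sum>i<n. (x i)\<^sup>2) \<le> a\<^sup>2 + b\<^sup>2" .
    have "(\<Prod>i<n. std_normal_density (x i)) = (1 / sqrt (2 * pi)) ^ n * exp (\<Sum>i<n. - (x i)\<^sup>2 / 2)"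
      by (simp add: std_normal_density_def prod_dividef exp_sum power_divide)
    also have "(\<Sum>i<n. - (x i)\<^sup>2 / 2) = - (\<Sum>i<n. (x i)\<^sup>2) / 2"
      by (simp add: sum_divide_distrib sum_negf)
    finally have "?C * (\<Prod>i<n. std_normal_density (x i))
      = exp ((a\<^sup>2 + b\<^sup>2) / 2) * exp (- (\<Sum>i<n. (x i)\<^sup>2) / 2)"
      by (simp add: power_divide)
    also have "\<dots> = exp ((a\<^sup>2 + b\<^sup>2 - (\<Sum>i<n. (x i)\<^sup>2)) / 2)"
      by (simp flip: exp_add add: diff_divide_distrib)
    also have "\<dots> \<ge> 1" using le by simp
    finally have "ennreal 1 \<le> ennreal (?C * (\<Prod>i<n. std_normal_density (x i)))"
      by (rule ennreal_leI)
    then show ?thesis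
      using True by (simp add: ennreal_mult prod_nonneg prod_ennreal)
  qed simp
  have "emeasure (lebesgue_Rn n) ?K = (\<integral>\<^sup>+x. indicator ?K x \<partial>lebesgue_Rn n)"
    using J by simp
  also have "\<dots> \<le> (\<integral>\<^sup>+x. ennreal ?C * (\<Prod>i<n. ennreal (std_normal_density (x i))) \<partial>lebesgue_Rn n)"
    by (intro nn_integral_mono pt)
  also have "\<dots> = ennreal ?C * (\<integral>\<^sup>+x. (\<Prod>i<n. ennreal (std_normal_density (x i))) \<partial>lebesgue_Rn n)"
    by (intro nn_integral_cmult borel_measurable_prod_ennreal)
       (auto intro!: measurable_compose[OF measurable_lebesgue_Rn_component])
  also have "(\<integral>\<^sup>+x. (\<Prod>i<n. ennreal (std_normal_density (x i))) \<partial>lebesgue_Rn n)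
      = (\<Prod>i<n. (\<integral>\<^sup>+t. ennreal (std_normal_density t) \<partial>lborel))"
    unfolding lebesgue_Rn_def by (rule lborel_product.product_nn_integral_prod) auto
  also have "(\<integral>\<^sup>+t. ennreal (std_normal_density t) \<partial>lborel) = 1"
    by (subst nn_integral_eq_integral) auto
  finally have "emeasure (lebesgue_Rn n) ?K \<le> ennreal ?C" by simp
  then show ?thesis
    unfolding vol_def measure_def by (simp add: enn2real_leI)
qed

section \<open>Dilations, symmetry, convexity and isotropy\<close>

lemma vscale_apply [simp]: "i < n \<Longrightarrow> vscale n t x i = t * x i"
  by (simp add: vscale_def)

lemma vscale_in_Rn [simp]: "vscale n t x \<in> Rn n"
  by (simp add: vscale_def Rn_def)

lemma vscale_vscale: "vscale n s (vscale n t x) = vscale n (s * t) x"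
  by (auto simp: vscale_def)

lemma vscale_one: "x \<in> Rn n \<Longrightarrow> vscale n 1 x = x"
  by (auto simp: vscale_def Rn_def PiE_def extensional_def fun_eq_iff)

lemma L2_set_vscale:
  assumes "J \<subseteq> {..<n}" shows "L2_set (vscale n t x) J = \<bar>t\<bar> * L2_set x J"
proof -
  have "(\<Sum>i\<in>J. (vscale n t x i)\<^sup>2) = t\<^sup>2 * (\<Sum>i\<in>J. (x i)\<^sup>2)"
    using assms by (auto simp: sum_distrib_left power_mult_distrib subset_iff intro!: sum.cong)
  then show ?thesis by (simp add: L2_set_def real_sqrt_mult)
qed

lemma dilate_block_body:
  assumes J: "J \<subseteq> {..<n}" and t: "t > 0"
  shows "dilate n t (block_body n J a b) = block_body n J (t * a) (t * b)"
proof (intro equalityI subsetI)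
  fix x assume "x \<in> dilate n t (block_body n J a b)"
  then show "x \<in> block_body n J (t * a) (t * b)"
    using J t by (auto simp: dilate_def block_body_def L2_set_vscale)
next
  fix x assume x: "x \<in> block_body n J (t * a) (t * b)"
  have "vscale n (1 / t) x \<in> block_body n J a b"
    using x J t by (auto simp: block_body_def L2_set_vscale field_simps)
  moreover have "x = vscale n t (vscale n (1 / t) x)"
    using x t by (simp add: vscale_vscale vscale_one block_body_def)
  ultimately show "x \<in> dilate n t (block_body n J a b)"
    unfolding dilate_def by blast
qed

lemma symmetric_block_body:
  assumes J: "J \<subseteq> {..<n}" shows "symmetric n (block_body n J a b)"
proof -
  have *: "vscale n (-1) x \<in> block_body n J a b" if "x \<in> block_body n J a b" for x
    using that J by (auto simp: block_body_def L2_set_vscale)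
  have "x \<in> dilate n (-1) (block_body n J a b)" if "x \<in> block_body n J a b" for x
  proof -
    have "x = vscale n (-1) (vscale n (-1) x)"
      using that by (simp add: vscale_vscale vscale_one block_body_def)
    then show ?thesis using *[OF that] unfolding dilate_def by blast
  qed
  then show ?thesis using * by (auto simp: symmetric_def dilate_def)
qed

lemma continuous_map_sum_squares:
  fixes n :: nat
  shows "J \<subseteq> {..<n} \<Longrightarrow> continuous_map (powertop_real {..<n}) euclideanreal (\<lambda>x. \<Sum>i\<in>J. (x i)\<^sup>2)"
  by (intro continuous_map_sum continuous_map_real_pow continuous_map_product_projection)
     (auto intro: finite_subset)

text \<open>The block sums of squares are continuous, which makes the body a closed subset of a
  compact cube; strict inequalities cut out an open subset containing the origin. Convexity is the
  triangle inequality in each block.\<close>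

lemma convex_body_block_body:
  assumes J: "J \<subseteq> {..<n}" and a: "a > 0" and b: "b > 0"
  shows "convex_body n (block_body n J a b)"
  unfolding convex_body_def
proof (intro conjI ballI allI impI)
  let ?X = "powertop_real {..<n}"
  let ?Jc = "{..<n} - J"
  have top: "topspace ?X = Rn n" by (simp add: Rn_def)
  \<comment> \<open>Squaring replaces the norms by polynomials, so that the body becomes an
    intersection of preimages of closed rays.\<close>
  have sq: "L2_set x I \<le> c \<longleftrightarrow> (\<Sum>i\<in>I. (x i)\<^sup>2) \<le> c\<^sup>2" if "c > 0" for x I and c :: real
    using that real_sqrt_le_iff[of "\<Sum>i\<in>I. (x i)\<^sup>2" "c\<^sup>2"] by (simp add: L2_set_def)
  have eq: "block_body n J a b = {x \<in> topspace ?X. (\<Sum>i\<in>J. (x i)\<^sup>2) \<in> {..a\<^sup>2}}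
      \<inter> {x \<in> topspace ?X. (\<Sum>i\<in>?Jc. (x i)\<^sup>2) \<in> {..b\<^sup>2}}"
    using a b unfolding top by (auto simp: block_body_def sq)
  have "closedin ?X (block_body n J a b)"
    unfolding eq using J
    by (intro closedin_Int closedin_continuous_map_preimage[OF continuous_map_sum_squares]) auto
  moreover have "compactin ?X (Pi\<^sub>E {..<n} (\<lambda>_. {- max a b .. max a b}))"
    by (subst compactin_PiE) auto
  moreover have "block_body n J a b \<subseteq> Pi\<^sub>E {..<n} (\<lambda>_. {- max a b .. max a b})"
  proof
    fix x assume x: "x \<in> block_body n J a b"
    then have "x i \<in> {- max a b .. max a b}" if "i < n" for i
      using block_body_coord_le[OF x that J] by (simp add: abs_le_iff)
    then show "x \<in> Pi\<^sub>E {..<n} (\<lambda>_. {- max a b .. max a b})"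
      using x by (auto simp: block_body_def Rn_def PiE_def)
  qed
  ultimately show "compactin ?X (block_body n J a b)"
    using closed_compactin by blast
  let ?U = "{x \<in> topspace ?X. (\<Sum>i\<in>J. (x i)\<^sup>2) \<in> {..<a\<^sup>2}}
      \<inter> {x \<in> topspace ?X. (\<Sum>i\<in>?Jc. (x i)\<^sup>2) \<in> {..<b\<^sup>2}}"
  have "openin ?X ?U"
    using J by (intro openin_Int openin_continuous_map_preimage[OF continuous_map_sum_squares]) auto
  moreover have "?U \<subseteq> block_body n J a b"
    unfolding eq by (intro Int_mono Collect_mono) auto
  moreover have "(\<lambda>i\<in>{..<n}. 0) \<in> ?U"
  proof -
    have "(\<Sum>i\<in>I. ((\<lambda>i\<in>{..<n}. 0 :: real) i)\<^sup>2) = 0" if "I \<subseteq> {..<n}" for I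
      using that by (intro sum.neutral) auto
    from this[OF J] this[OF Diff_subset] show ?thesis
      using a b by (simp add: PiE_def)
  qed
  ultimately show "?X interior_of block_body n J a b \<noteq> {}"
    using interior_of_maximal by blast
next
  fix x y and u v :: real
  assume x: "x \<in> block_body n J a b" and y: "y \<in> block_body n J a b"
    and uv: "u \<ge> 0" "v \<ge> 0" "u + v = 1"
  have *: "L2_set (vadd n (vscale n u x) (vscale n v y)) I \<le> c"
    if "I \<subseteq> {..<n}" "L2_set x I \<le> c" "L2_set y I \<le> c" for I c
  proof -
    have "L2_set (vadd n (vscale n u x) (vscale n v y)) I
        = L2_set (\<lambda>i. vscale n u x i + vscale n v y i) I"
      using that by (intro L2_set_cong) (auto simp: vadd_def)
    also have "\<dots> \<le> L2_set (vscale n u x) I + L2_set (vscale n v y) I"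
      by (rule L2_set_triangle_ineq)
    also have "\<dots> \<le> u * c + v * c"
      using that uv by (simp add: L2_set_vscale add_mono mult_left_mono)
    also have "\<dots> = c" using uv by (simp flip: distrib_right)
    finally show ?thesis .
  qed
  have "vadd n (vscale n u x) (vscale n v y) \<in> Rn n"
    by (simp add: vadd_def Rn_def)
  then show "vadd n (vscale n u x) (vscale n v y) \<in> block_body n J a b"
    using x y J by (auto simp: block_body_def *)
qed

text \<open>The matrix of second moments is \<open>c\<^sup>2\<close> times the identity: mixed
  moments vanish by reflection, and the radii are tuned so that both blocks have the same diagonal
  entries. The witness for the isotropic constant is \<open>c\<close>.\<close>

lemma isotropic_block_body:
  assumes J: "J \<subseteq> {..<n}" and c: "c > 0"
    and a: "a = c * sqrt (real (card J) + 2)" and b: "b = c * sqrt (real (n - card J) + 2)"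
    and vol: "vol n (block_body n J a b) = 1"
  shows "isotropic n (block_body n J a b)"
  unfolding isotropic_def
proof (intro conjI exI ballI)
  have fin: "finite J" using J finite_subset by blast
  have ab: "a > 0" "b > 0" using c by (auto simp: a b)
  show "convex_body n (block_body n J a b)" using J ab by (rule convex_body_block_body)
  show "vol n (block_body n J a b) = 1" by fact
  show "barycenter n (block_body n J a b) = (\<lambda>i\<in>{..<n}. 0)"
    using J by (auto simp: barycenter_def block_first_moment)
  show "0 < c" by fact
  fix \<theta> assume \<theta>: "\<theta> \<in> unit_sphere n"
  have diag: "(LINT x:block_body n J a b|lebesgue_Rn n. x i * x i) = c\<^sup>2" if i: "i < n" for i
  proof (cases "i \<in> J")
    case True
    then show ?thesis
      using block_coord_second_moment[OF J True ab] vol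
      by (simp add: a power_mult_distrib)
  next
    case False
    then have "i \<in> {..<n} - J" using i by simp
    moreover have "card ({..<n} - J) = n - card J"
      using J fin by (simp add: card_Diff_subset)
    ultimately show ?thesis
      \<comment> \<open>The moment formula is used for the complementary block, with the radii
        exchanged, and read back through \<open>block_body_swap\<close>.\<close>
      using block_coord_second_moment[OF Diff_subset _ ab(2,1), of i n J] vol
      by (simp add: block_body_swap[OF J] b power_mult_distrib)
  qed
  have int: "integrable (lebesgue_Rn n) (\<lambda>x. indicator (block_body n J a b) x * (x i * x j))"
    if "i < n" "j < n" for i j
    using set_integrable_coord_prod[OF J that, of a b] by (simp add: set_integrable_def)
  have "(LINT x:block_body n J a b|lebesgue_Rn n. (dot n x \<theta>)\<^sup>2)
      = (LINT x|lebesgue_Rn n. (\<Sum>i<n. \<Sum>j<n. \<theta> i * \<theta> j * (indicator (block_body n J a b) x * (x i * x j))))"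
    unfolding set_lebesgue_integral_def
    by (intro Bochner_Integration.integral_cong)
       (simp_all add: dot_def power2_eq_square sum_product sum_distrib_left mult_ac)
  also have "\<dots> = (\<Sum>i<n. \<Sum>j<n. \<theta> i * \<theta> j * (LINT x:block_body n J a b|lebesgue_Rn n. x i * x j))"
    unfolding set_lebesgue_integral_def real_scaleR_def using int
    by (subst Bochner_Integration.integral_sum Bochner_Integration.integral_mult_right_zero
        , auto intro!: Bochner_Integration.integrable_sum sum.cong)+
  also have "\<dots> = (\<Sum>i<n. \<Sum>j<n. if i = j then \<theta> i * \<theta> i * c\<^sup>2 else 0)"
    using J by (intro sum.cong) (auto simp: diag block_mixed_moment)
  also have "\<dots> = dot n \<theta> \<theta> * c\<^sup>2"
    by (simp add: dot_def sum_distrib_right)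
  also have "\<dots> = c\<^sup>2" using \<theta> by (simp add: unit_sphere_def)
  finally show "(LINT x:block_body n J a b|lebesgue_Rn n. (dot n x \<theta>)\<^sup>2) = c\<^sup>2" .
qed

section \<open>Gauge, inradius and mean gauge\<close>

lemma L2_set_split:
  assumes "J \<subseteq> {..<n::nat}"
  shows "(L2_set x {..<n})\<^sup>2 = (L2_set x J)\<^sup>2 + (L2_set x ({..<n} - J))\<^sup>2"
proof -
  have "(\<Sum>i<n. (x i)\<^sup>2) = (\<Sum>i\<in>{..<n} - J. (x i)\<^sup>2) + (\<Sum>i\<in>J. (x i)\<^sup>2)"
    using assms by (intro sum.subset_diff) auto
  then show ?thesis by (simp add: L2_set_def sum_nonneg)
qed

lemma L2_set_mono_subset:
  assumes "J \<subseteq> I" "finite I" shows "L2_set x J \<le> L2_set x I"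
  unfolding L2_set_def using assms by (intro real_sqrt_le_mono sum_mono2) auto

lemma sqrt_dot_self: "sqrt (dot n x x) = L2_set x {..<n}"
  by (simp add: dot_def L2_set_def power2_eq_square)

lemma abs_dot_le: "\<bar>\<Sum>i\<in>J. x i * y i\<bar> \<le> L2_set x J * L2_set y J"
proof -
  have "\<bar>\<Sum>i\<in>J. x i * y i\<bar> \<le> (\<Sum>i\<in>J. \<bar>x i\<bar> * \<bar>y i\<bar>)"
    unfolding abs_mult[symmetric] by (rule sum_abs)
  also have "\<dots> \<le> L2_set x J * L2_set y J" by (rule L2_set_mult_ineq)
  finally show ?thesis .
qed

lemma unit_sphere_iff: "x \<in> unit_sphere n \<longleftrightarrow> x \<in> Rn n \<and> L2_set x {..<n} = 1"
  by (simp add: unit_sphere_def sqrt_dot_self)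

lemma unit_ball_eq_block_body: "unit_ball n = block_body n {..<n} 1 0"
  by (simp add: unit_ball_def block_body_def sqrt_dot_self)

lemma dilate_unit_ball:
  "t > 0 \<Longrightarrow> dilate n t (unit_ball n) = {x \<in> Rn n. L2_set x {..<n} \<le> t}"
  by (simp add: unit_ball_eq_block_body dilate_block_body) (simp add: block_body_def)

definition axis_vec :: "nat \<Rightarrow> nat \<Rightarrow> rvec" where
  "axis_vec n k = (\<lambda>i\<in>{..<n}. if i = k then 1 else 0)"

lemma axis_vec_apply [simp]: "i < n \<Longrightarrow> axis_vec n k i = (if i = k then 1 else 0)"
  by (simp add: axis_vec_def)

lemma axis_vec_in_Rn [simp]: "axis_vec n k \<in> Rn n"
  by (simp add: axis_vec_def Rn_def)

lemma L2_set_axis_vec: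
  assumes "J \<subseteq> {..<n}"
  shows "L2_set (axis_vec n k) J = (if k \<in> J then 1 else 0)"
proof -
  have fin: "finite J" using assms finite_subset by blast
  have "(\<Sum>i\<in>J. (axis_vec n k i)\<^sup>2) = (\<Sum>i\<in>J. if i = k then 1 else 0)"
    using assms by (intro sum.cong) (auto simp: subset_iff)
  then show ?thesis using fin by (simp add: L2_set_def)
qed

lemma gauge_block_body:
  assumes J: "J \<subseteq> {..<n}" and ab: "a > 0" "b > 0" and x: "x \<in> Rn n"
  shows "gauge n (block_body n J a b) x = max (L2_set x J / a) (L2_set x ({..<n} - J) / b)"
proof -
  define g where "g = max (L2_set x J / a) (L2_set x ({..<n} - J) / b)"
  have g0: "g \<ge> 0" using ab by (simp add: g_def le_max_iff_disj)
  have set: "{t. 0 < t \<and> x \<in> dilate n t (block_body n J a b)} = {t. 0 < t \<and> g \<le> t}"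
    using J ab x by (auto simp: dilate_block_body) (auto simp: block_body_def g_def field_simps)
  \<comment> \<open>At the origin \<open>g\<close> is 0 and does not belong to the set, so the
    infimum need not be attained; hence the argument with \<open>g + e\<close>.\<close>
  have "Inf {t. 0 < t \<and> g \<le> t} = g"
  proof (rule cInf_eq_non_empty)
    show "{t. 0 < t \<and> g \<le> t} \<noteq> {}" using g0 by (auto intro!: exI[of _ "g + 1"])
    fix y assume y: "\<And>t. t \<in> {t. 0 < t \<and> g \<le> t} \<Longrightarrow> y \<le> t"
    show "y \<le> g"
    proof (rule field_le_epsilon)
      fix e :: real assume "e > 0" then show "y \<le> g + e" using g0 by (intro y) auto
    qed
  qed auto
  then show ?thesis unfolding gauge_def set g_def .
qed

text \<open>A ball fits as long as its radius does not exceed the smaller radius \<open>a\<close>,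
  since block norms are at most the full norm. A coordinate vector of the block \<open>J\<close>
  shows that nothing larger fits.\<close>

lemma inradius_block_body:
  assumes J: "J \<subseteq> {..<n}" "J \<noteq> {}" and ab: "0 < a" "a \<le> b"
  shows "inradius n (block_body n J a b) = a"
proof -
  obtain k where k: "k \<in> J" using J by blast
  have "{r. 0 < r \<and> dilate n r (unit_ball n) \<subseteq> block_body n J a b} = {0<..a}"
  proof (intro equalityI subsetI)
    fix r assume "r \<in> {r. 0 < r \<and> dilate n r (unit_ball n) \<subseteq> block_body n J a b}"
    then have r: "0 < r" "dilate n r (unit_ball n) \<subseteq> block_body n J a b" by auto
    have kn: "k < n" using k J by auto
    have "vscale n r (axis_vec n k) \<in> dilate n r (unit_ball n)"
      using r kn by (simp add: dilate_unit_ball L2_set_vscale L2_set_axis_vec)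
    then have "vscale n r (axis_vec n k) \<in> block_body n J a b" using r by blast
    then have "r \<le> a"
      using k r J by (simp add: block_body_def L2_set_vscale L2_set_axis_vec)
    then show "r \<in> {0<..a}" using r by simp
  next
    fix r assume r: "r \<in> {0<..a}"
    have "x \<in> block_body n J a b" if "x \<in> Rn n" "L2_set x {..<n} \<le> r" for x
      using that r ab L2_set_mono_subset[OF J(1), of x] L2_set_mono_subset[OF Diff_subset, of "{..<n}" x J]
      by (simp add: block_body_def)
    then show "r \<in> {r. 0 < r \<and> dilate n r (unit_ball n) \<subseteq> block_body n J a b}"
      using r by (auto simp: dilate_unit_ball)
  qed
  then show ?thesis using ab by (simp add: inradius_def)
qed

text \<open>Coordinate vectors of the block with the smaller radius attain the maximum.\<close>

lemma gauge_max_block_body: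
  assumes J: "J \<subseteq> {..<n}" "J \<noteq> {}" and ab: "0 < a" "a \<le> b"
  shows "gauge_max n (block_body n J a b) = 1 / a"
proof -
  obtain k where k: "k \<in> J" using J by blast
  have b: "b > 0" using ab by simp
  have le: "gauge n (block_body n J a b) x \<le> 1 / a" if "x \<in> unit_sphere n" for x
  proof -
    have x: "x \<in> Rn n" "L2_set x {..<n} = 1" using that by (auto simp: unit_sphere_iff)
    have "L2_set x J \<le> 1" "L2_set x ({..<n} - J) \<le> 1"
      using x L2_set_mono_subset[OF J(1), of x] L2_set_mono_subset[OF Diff_subset, of "{..<n}" x J]
      by auto
    then have "L2_set x J / a \<le> 1 / a" "L2_set x ({..<n} - J) / b \<le> 1 / a"
      using ab b by (auto intro!: divide_right_mono frac_le)
    then show ?thesis using J ab b x by (simp add: gauge_block_body)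
  qed
  have kn: "k < n" using k J by auto
  have e: "axis_vec n k \<in> unit_sphere n"
    using kn by (simp add: unit_sphere_iff L2_set_axis_vec)
  have "gauge n (block_body n J a b) (axis_vec n k) = 1 / a"
    using J k ab b by (simp add: gauge_block_body L2_set_axis_vec)
  then show ?thesis
    unfolding gauge_max_def using le e by (intro cSup_eq_maximum) (auto intro: rev_image_eqI)
qed

section \<open>The rotation invariant measure on the sphere\<close>

lemma orthogonal_groupI:
  assumes "U \<in> {..<n} \<times> {..<n} \<rightarrow>\<^sub>E UNIV"
    and cols: "\<And>a b. a < n \<Longrightarrow> b < n \<Longrightarrow> (\<Sum>k<n. U (k, a) * U (k, b)) = (if a = b then 1 else 0)"
  shows "U \<in> orthogonal_group n"
proof -
  have "mat_mult n (adjoint_mat n U) U (a, b) = (\<lambda>(i, j)\<in>{..<n} \<times> {..<n}. if i = j then 1 else 0) (a, b)"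
    for a b
  proof (cases "a < n \<and> b < n")
    case True
    then show ?thesis by (simp add: mat_mult_def adjoint_mat_def cols)
  next
    \<comment> \<open>Outside the index square both extensional functions take the value
      \<open>undefined\<close>.\<close>
    case False
    then have "(a, b) \<notin> {..<n} \<times> {..<n}" by simp
    then show ?thesis by (simp only: mat_mult_def restrict_apply if_False)
  qed
  then have "mat_mult n (adjoint_mat n U) U = (\<lambda>(i, j)\<in>{..<n} \<times> {..<n}. if i = j then 1 else 0)"
    by (intro ext) (metis surj_pair)
  then show ?thesis
    unfolding orthogonal_group_def using assms(1) by simp
qed

lemma sphere_measure_coord_measurable:
  assumes "sphere_measure n \<sigma>" "k < n"
  shows "(\<lambda>x. x k) \<in> borel_measurable \<sigma>"
proof -
  have sets: "sets \<sigma> = sets (restrict_space (Pi\<^sub>M {..<n} (\<lambda>_. borel)) (unit_sphere n))"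
    using assms by (simp add: sphere_measure_def)
  have "(\<lambda>x. x k) \<in> borel_measurable (restrict_space (Pi\<^sub>M {..<n} (\<lambda>_. borel :: real measure)) (unit_sphere n))"
    using assms by (intro measurable_restrict_space1 measurable_component_singleton) auto
  then show ?thesis by (simp add: measurable_cong_sets[OF sets refl])
qed

lemma sphere_measure_coord_square_integrable:
  assumes \<sigma>: "sphere_measure n \<sigma>" and k: "k < n"
  shows "integrable \<sigma> (\<lambda>x. (x k)\<^sup>2)"
proof -
  interpret prob_space \<sigma> using \<sigma> by (simp add: sphere_measure_def)
  have "norm ((x k)\<^sup>2) \<le> 1" if "x \<in> space \<sigma>" for x
  proof -
    have "\<bar>x k\<bar> \<le> 1"
      using abs_le_L2_set[of "{..<n}" k x] that \<sigma> k by (simp add: sphere_measure_def unit_sphere_iff)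
    then show ?thesis by (simp add: abs_square_le_1)
  qed
  then show ?thesis
    using sphere_measure_coord_measurable[OF \<sigma> k] by (intro integrable_const_bound[of _ 1]) auto
qed

text \<open>Invariance under the coordinate transpositions makes the second moments of all coordinates
  equal, and they add up to 1.\<close>

lemma sphere_measure_coord_second_moment:
  assumes \<sigma>: "sphere_measure n \<sigma>" and i: "i < n"
  shows "(LINT x|\<sigma>. (x i)\<^sup>2) = 1 / real n"
proof -
  interpret prob_space \<sigma> using \<sigma> by (simp add: sphere_measure_def)
  have space: "space \<sigma> = unit_sphere n" and
    sets: "sets \<sigma> = sets (restrict_space (Pi\<^sub>M {..<n} (\<lambda>_. borel)) (unit_sphere n))" and
    inv: "\<And>U. U \<in> orthogonal_group n \<Longrightarrow> distr \<sigma> \<sigma> (mat_apply n U) = \<sigma>"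
    using \<sigma> by (auto simp: sphere_measure_def)
  note meas = sphere_measure_coord_measurable[OF \<sigma>]
  note int = sphere_measure_coord_square_integrable[OF \<sigma>]
  have eq: "(LINT x|\<sigma>. (x j)\<^sup>2) = (LINT x|\<sigma>. (x i)\<^sup>2)" if j: "j < n" for j
  proof -
    \<comment> \<open>Invariance is available only for orthogonal matrices, so the transposition is
      written as its permutation matrix \<open>U\<close>.\<close>
    define p where "p = Transposition.transpose i j"
    define U :: rmat where "U = (\<lambda>(k, l)\<in>{..<n} \<times> {..<n}. if l = p k then 1 else 0)"
    have p: "p k < n" if "k < n" for k
      using that i j by (auto simp: p_def Transposition.transpose_def)
    have pp: "p (p k) = k" for k by (simp add: p_def)
    have Ux: "mat_apply n U x k = x (p k)" if "k < n" for x k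
      using that p[OF that] by (simp add: mat_apply_def U_def if_distrib[of "\<lambda>t. t * _"] cong: if_cong)
    have cols: "(\<Sum>k<n. U (k, a) * U (k, b)) = (if a = b then 1 else 0)" if "a < n" "b < n" for a b
    proof -
      have "(\<Sum>k<n. U (k, a) * U (k, b)) = (\<Sum>k<n. if k = p a then if a = b then 1 else 0 else 0)"
      proof (rule sum.cong[OF refl])
        fix k assume k: "k \<in> {..<n}"
        show "U (k, a) * U (k, b) = (if k = p a then if a = b then 1 else 0 else 0)"
        proof (cases "k = p a")
          case True
          then show ?thesis using that p by (auto simp: U_def pp)
        next
          case False
          then have "a \<noteq> p k" using pp by metis
          then show ?thesis using that False k by (simp add: U_def)
        qed
      qed
      then show ?thesis using p[OF that(1)] by simp
    qed
    have U: "U \<in> orthogonal_group n"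
      unfolding U_def by (rule orthogonal_groupI[OF _ cols[unfolded U_def]]) (simp_all add: restrict_def PiE_def extensional_def)
    \<comment> \<open>The space of \<sigma> is the sphere and not the whole of \<open>Rn n\<close>,
      so measurability includes the fact that \<open>U\<close> preserves the norm.\<close>
    have mU: "mat_apply n U \<in> measurable \<sigma> \<sigma>"
    proof -
      have "mat_apply n U \<in> measurable \<sigma> (restrict_space (Pi\<^sub>M {..<n} (\<lambda>_. borel)) (unit_sphere n))"
      proof (rule measurable_restrict_space2)
        show "mat_apply n U \<in> space \<sigma> \<rightarrow> unit_sphere n"
        proof
          fix x assume x: "x \<in> space \<sigma>"
          have "bij_betw p {..<n} {..<n}"
            using i j permutes_swap_id[of i "{..<n}" j] by (auto simp: p_def permutes_imp_bij)
          then have "(\<Sum>k<n. (x (p k))\<^sup>2) = (\<Sum>k<n. (x k)\<^sup>2)"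
            by (rule sum.reindex_bij_betw)
          then have "L2_set (mat_apply n U x) {..<n} = L2_set x {..<n}"
            by (simp add: L2_set_def Ux)
          then show "mat_apply n U x \<in> unit_sphere n"
            using x by (simp add: space unit_sphere_iff) (simp add: mat_apply_def Rn_def)
        qed
        show "mat_apply n U \<in> measurable \<sigma> (Pi\<^sub>M {..<n} (\<lambda>_. borel))"
          unfolding mat_apply_def using meas
          by (intro measurable_restrict borel_measurable_sum borel_measurable_times) auto
      qed
      then show ?thesis by (simp add: measurable_cong_sets[OF refl sets])
    qed
    have "(LINT x|\<sigma>. (x j)\<^sup>2) = (LINT x|distr \<sigma> \<sigma> (mat_apply n U). (x j)\<^sup>2)"
      using inv[OF U] by simp
    also have "\<dots> = (LINT x|\<sigma>. (mat_apply n U x j)\<^sup>2)"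
      using mU meas[OF j] by (intro integral_distr) auto
    also have "\<dots> = (LINT x|\<sigma>. (x i)\<^sup>2)"
      using j by (simp add: Ux p_def)
    finally show ?thesis .
  qed
  have "real n * (LINT x|\<sigma>. (x i)\<^sup>2) = (\<Sum>j<n. LINT x|\<sigma>. (x j)\<^sup>2)"
    using eq by simp
  also have "\<dots> = (LINT x|\<sigma>. (\<Sum>j<n. (x j)\<^sup>2))"
    using int by (intro Bochner_Integration.integral_sum[symmetric]) auto
  also have "\<dots> = (LINT x|\<sigma>. 1)"
  proof (rule Bochner_Integration.integral_cong)
    fix x assume "x \<in> space \<sigma>"
    then have "L2_set x {..<n} = 1" by (simp add: space unit_sphere_iff)
    then show "(\<Sum>j<n. (x j)\<^sup>2) = 1" by (simp add: L2_set_def)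
  qed simp
  finally show ?thesis
    using i prob_space by (simp add: field_simps)
qed

text \<open>The lower bound holds pointwise: the block norms are at most \<open>g * a\<close> and
  \<open>g * b\<close> for the gauge \<open>g\<close>, and their squares add up to 1. For the upper
  bound the maximum is replaced by the sum, the second block norm by 1, and the mean of the first by
  its root mean square.\<close>

lemma sphere_measure_gauge_block_body:
  assumes \<sigma>: "sphere_measure n \<sigma>" and J: "J \<subseteq> {..<n}" "J \<noteq> {}" and ab: "0 < a" "0 < b"
  shows "1 / sqrt (a\<^sup>2 + b\<^sup>2) \<le> gauge_mean n \<sigma> (block_body n J a b)"
    and "gauge_mean n \<sigma> (block_body n J a b) \<le> sqrt (real (card J) / real n) / a + 1 / b"
proof -
  let ?g = "gauge n (block_body n J a b)"
  interpret prob_space \<sigma> using \<sigma> by (simp add: sphere_measure_def)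
  have space: "space \<sigma> = unit_sphere n" and
    sets: "sets \<sigma> = sets (restrict_space (Pi\<^sub>M {..<n} (\<lambda>_. borel)) (unit_sphere n))"
    using \<sigma> by (auto simp: sphere_measure_def)
  have fin: "finite J" using J finite_subset by blast
  have card: "card J > 0" using J fin by auto
  have n: "n > 0" using J by (cases n) auto
  note meas = sphere_measure_coord_measurable[OF \<sigma>]
  have mL: "(\<lambda>x. L2_set x I) \<in> borel_measurable \<sigma>" if "I \<subseteq> {..<n}" for I
  proof -
    have "(\<lambda>x. \<Sum>i\<in>I. (x i)\<^sup>2) \<in> borel_measurable \<sigma>"
      using that meas by (intro borel_measurable_sum borel_measurable_power) auto
    then show ?thesis unfolding L2_set_def by measurable
  qed
  have geq: "?g x = max (L2_set x J / a) (L2_set x ({..<n} - J) / b)" if "x \<in> space \<sigma>" for x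
    using that J ab by (simp add: gauge_block_body space unit_sphere_iff)
  have L1: "L2_set x I \<le> 1" if "I \<subseteq> {..<n}" "x \<in> space \<sigma>" for x I
    using that L2_set_mono_subset[of I "{..<n}" x] by (simp add: space unit_sphere_iff)
  have [measurable]: "(\<lambda>x. L2_set x J) \<in> borel_measurable \<sigma>"
    "(\<lambda>x. L2_set x ({..<n} - J)) \<in> borel_measurable \<sigma>"
    using mL J by auto
  have gm: "?g \<in> borel_measurable \<sigma>"
    by (subst measurable_cong[OF geq]) auto
  have gle: "?g x \<le> L2_set x J / a + L2_set x ({..<n} - J) / b" if "x \<in> space \<sigma>" for x
    using geq[OF that] ab by simp
  have gi: "integrable \<sigma> ?g"
  proof (rule integrable_const_bound)
    show "AE x in \<sigma>. norm (?g x) \<le> 1 / a + 1 / b"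
    proof (rule AE_I2)
      fix x assume x: "x \<in> space \<sigma>"
      have "L2_set x J / a \<le> 1 / a" "L2_set x ({..<n} - J) / b \<le> 1 / b"
        using L1[OF _ x] J ab by (auto intro!: divide_right_mono)
      moreover have "0 \<le> ?g x" using geq[OF x] ab by (simp add: le_max_iff_disj)
      ultimately show "norm (?g x) \<le> 1 / a + 1 / b"
        using gle[OF x] by simp
    qed
  qed fact
  have "1 / sqrt (a\<^sup>2 + b\<^sup>2) \<le> ?g x" if x: "x \<in> space \<sigma>" for x
  proof -
    have g0: "?g x \<ge> 0" using geq[OF x] ab by (simp add: le_max_iff_disj)
    have "L2_set x J \<le> ?g x * a" "L2_set x ({..<n} - J) \<le> ?g x * b"
      using geq[OF x] ab by (simp_all add: field_simps max_def)
    then have "(L2_set x J)\<^sup>2 + (L2_set x ({..<n} - J))\<^sup>2 \<le> (?g x * a)\<^sup>2 + (?g x * b)\<^sup>2"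
      by (intro add_mono power_mono) auto
    moreover have "(L2_set x {..<n})\<^sup>2 = 1" using x by (simp add: space unit_sphere_iff)
    ultimately have "1 \<le> (?g x)\<^sup>2 * (a\<^sup>2 + b\<^sup>2)"
      using L2_set_split[OF J(1), of x] by (simp add: power_mult_distrib algebra_simps)
    then have "sqrt 1 \<le> sqrt ((?g x)\<^sup>2 * (a\<^sup>2 + b\<^sup>2))" by (intro real_sqrt_le_mono)
    then have "1 \<le> ?g x * sqrt (a\<^sup>2 + b\<^sup>2)" using g0 by (simp add: real_sqrt_mult)
    moreover have "sqrt (a\<^sup>2 + b\<^sup>2) > 0" using ab by (simp add: add_pos_pos)
    ultimately show ?thesis by (simp add: field_simps)
  qed
  then have "(LINT x|\<sigma>. 1 / sqrt (a\<^sup>2 + b\<^sup>2)) \<le> (LINT x|\<sigma>. ?g x)"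
    using gi by (intro integral_mono) auto
  then show "1 / sqrt (a\<^sup>2 + b\<^sup>2) \<le> gauge_mean n \<sigma> (block_body n J a b)"
    using prob_space by (simp add: gauge_mean_def)
  \<comment> \<open>\<open>q\<close> is the root mean square of \<open>L2_set x J\<close> under
    \<sigma>.\<close>
  define q where "q = sqrt (real (card J) / real n)"
  have q: "q > 0" "q\<^sup>2 = real (card J) / real n" using card n by (auto simp: q_def)
  note int = sphere_measure_coord_square_integrable[OF \<sigma>]
  \<comment> \<open>The inequality \<open>2 * L * q \<le> L\<^sup>2 + q\<^sup>2\<close> bounds the
    norm by an affine function of its square. With this \<open>q\<close> the integral of that bound
    is exactly \<open>q / a + 1 / b\<close>, which replaces an appeal to the Cauchy-Schwarz
    inequality for integrals.\<close>
  let ?h = "\<lambda>x::rvec. ((\<Sum>k\<in>J. (x k)\<^sup>2) / q + q) / (2 * a) + 1 / b"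
  have intJ: "integrable \<sigma> (\<lambda>x. (\<Sum>k\<in>J. (x k)\<^sup>2))"
    using int J by (intro Bochner_Integration.integrable_sum) auto
  have "?g x \<le> ?h x" if x: "x \<in> space \<sigma>" for x
  proof -
    have "L2_set x ({..<n} - J) / b \<le> 1 / b"
      using L1[OF _ x] J ab by (auto intro!: divide_right_mono)
    moreover have "L2_set x J / a \<le> ((L2_set x J)\<^sup>2 / q + q) / (2 * a)"
    proof -
      have "0 \<le> (L2_set x J - q)\<^sup>2" by simp
      then have "2 * L2_set x J * q \<le> (L2_set x J)\<^sup>2 + q\<^sup>2" by (simp add: power2_diff)
      then have "2 * L2_set x J \<le> (L2_set x J)\<^sup>2 / q + q"
        using q(1) by (simp add: field_simps power2_eq_square)
      then show ?thesis using ab by (simp add: field_simps)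
    qed
    moreover have "(L2_set x J)\<^sup>2 = (\<Sum>k\<in>J. (x k)\<^sup>2)" by (simp add: L2_set_def sum_nonneg)
    ultimately show ?thesis using gle[OF x] by simp
  qed
  then have "(LINT x|\<sigma>. ?g x) \<le> (LINT x|\<sigma>. ?h x)"
    using gi intJ by (intro integral_mono) auto
  also have "\<dots> = ((LINT x|\<sigma>. (\<Sum>k\<in>J. (x k)\<^sup>2)) / q + q) / (2 * a) + 1 / b"
    using intJ prob_space by simp
  also have "(LINT x|\<sigma>. (\<Sum>k\<in>J. (x k)\<^sup>2)) = (\<Sum>k\<in>J. 1 / real n)"
  proof -
    have "(LINT x|\<sigma>. (\<Sum>k\<in>J. (x k)\<^sup>2)) = (\<Sum>k\<in>J. LINT x|\<sigma>. (x k)\<^sup>2)"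
      using int J by (intro Bochner_Integration.integral_sum) auto
    also have "\<dots> = (\<Sum>k\<in>J. 1 / real n)"
      using J by (intro sum.cong sphere_measure_coord_second_moment[OF \<sigma>]) auto
    finally show ?thesis .
  qed
  also have "(\<Sum>k\<in>J. 1 / real n) = q\<^sup>2" using q by simp
  also have "(q\<^sup>2 / q + q) / (2 * a) = q / a"
    using q(1) ab by (simp add: power2_eq_square)
  finally show "gauge_mean n \<sigma> (block_body n J a b) \<le> sqrt (real (card J) / real n) / a + 1 / b"
    by (simp add: gauge_mean_def q_def)
qed

section \<open>Averages of rotated polars\<close>

lemma orthogonal_group_columns:
  assumes U: "U \<in> orthogonal_group n" and ab: "a < n" "b < n"
  shows "(\<Sum>k<n. U (k, a) * U (k, b)) = (if a = b then 1 else 0)"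
proof -
  have "mat_mult n (adjoint_mat n U) U (a, b) = (\<lambda>(i, j)\<in>{..<n} \<times> {..<n}. if i = j then 1 else 0) (a, b)"
    using U by (simp add: orthogonal_group_def)
  then show ?thesis using ab by (simp add: mat_mult_def adjoint_mat_def)
qed

lemma orthogonal_group_adjoint_apply:
  assumes U: "U \<in> orthogonal_group n" and i: "i < n"
  shows "(\<Sum>k<n. U (k, i) * (\<Sum>l<n. U (k, l) * x l)) = x i"
proof -
  have "(\<Sum>k<n. U (k, i) * (\<Sum>l<n. U (k, l) * x l)) = (\<Sum>k<n. \<Sum>l<n. U (k, i) * U (k, l) * x l)"
    by (simp add: sum_distrib_left mult_ac)
  also have "\<dots> = (\<Sum>l<n. \<Sum>k<n. U (k, i) * U (k, l) * x l)"
    by (rule sum.swap)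
  also have "\<dots> = (\<Sum>l<n. (if i = l then 1 else 0) * x l)"
    using i by (intro sum.cong) (simp_all add: orthogonal_group_columns[OF U] flip: sum_distrib_right)
  also have "\<dots> = x i"
    using i by (simp add: if_distrib[of "\<lambda>t. t * _"] cong: if_cong)
  finally show ?thesis .
qed

lemma orthogonal_group_isometry:
  assumes U: "U \<in> orthogonal_group n"
  shows "(\<Sum>k<n. (\<Sum>l<n. U (k, l) * x l)\<^sup>2) = (\<Sum>i<n. (x i)\<^sup>2)"
proof -
  let ?y = "\<lambda>k. \<Sum>l<n. U (k, l) * x l"
  have "(\<Sum>k<n. (?y k)\<^sup>2) = (\<Sum>k<n. \<Sum>i<n. U (k, i) * x i * ?y k)"
    by (simp add: power2_eq_square sum_distrib_right)
  also have "\<dots> = (\<Sum>i<n. \<Sum>k<n. U (k, i) * x i * ?y k)"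
    by (rule sum.swap)
  also have "\<dots> = (\<Sum>i<n. x i * (\<Sum>k<n. U (k, i) * ?y k))"
    unfolding sum_distrib_left by (intro sum.cong refl) (simp add: sum_distrib_left mult_ac)
  also have "\<dots> = (\<Sum>i<n. x i * x i)"
    by (intro sum.cong) (simp_all add: orthogonal_group_adjoint_apply[OF U])
  finally show ?thesis by (simp add: power2_eq_square)
qed

text \<open>\<open>orthogonal_group\<close> only provides \<open>U\<^sup>* U = 1\<close>. Since \<open>U\<close> is an isometry, applying it to
  its own \<open>k\<close>-th row \<open>v\<close> gives \<open>\<bar>v\<bar>\<^sup>4 \<le> \<bar>v\<bar>\<^sup>2\<close>, so every row has norm at most 1; the squared
  norms of all rows add up to \<open>n\<close>.\<close>

lemma orthogonal_group_rows:
  assumes U: "U \<in> orthogonal_group n" and k: "k < n"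
  shows "(\<Sum>i<n. (U (k, i))\<^sup>2) = 1"
proof -
  define r where "r = (\<lambda>k. \<Sum>i<n. (U (k, i))\<^sup>2)"
  have r1: "r k \<le> 1" if "k < n" for k
  proof -
    have r0: "r k \<ge> 0" by (simp add: r_def sum_nonneg)
    have "(r k)\<^sup>2 = (\<Sum>l<n. U (k, l) * U (k, l))\<^sup>2" by (simp add: r_def power2_eq_square)
    also have "\<dots> \<le> (\<Sum>k'<n. (\<Sum>l<n. U (k', l) * U (k, l))\<^sup>2)"
      using that by (intro member_le_sum[of k "{..<n}" "\<lambda>k'. (\<Sum>l<n. U (k', l) * U (k, l))\<^sup>2"]) auto
    also have "\<dots> = r k"
      unfolding r_def by (rule orthogonal_group_isometry[OF U])
    finally have "r k * r k \<le> 1 * r k" by (simp add: power2_eq_square)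
    then show ?thesis using r0 by (cases "r k = 0") (auto simp: mult_le_cancel_right)
  qed
  have "(\<Sum>k<n. r k) = (\<Sum>i<n. \<Sum>k<n. (U (k, i))\<^sup>2)"
    unfolding r_def by (rule sum.swap)
  also have "\<dots> = (\<Sum>i<n. 1)"
    using orthogonal_group_columns[OF U] by (intro sum.cong) (auto simp: power2_eq_square)
  finally have "(\<Sum>k<n. 1 - r k) = 0" by (simp add: sum_subtractf)
  then have "1 - r k = 0" using k r1 by (subst (asm) sum_nonneg_eq_0_iff) auto
  then show ?thesis by (simp add: r_def)
qed

section \<open>The average of rotated polars: inner and outer radius\<close>

lemma polar_average_iff:
  "x \<in> polar_average n m U K \<longleftrightarrow>
    (\<exists>y. (\<forall>j\<in>{1..m}. y j \<in> polar n K) \<and>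
      x = (\<lambda>i\<in>{..<n}. (\<Sum>j=1..m. \<Sum>k<n. U j (k, i) * y j k) / real m))" (is "?L \<longleftrightarrow> ?R")
proof -
  \<comment> \<open>The adjoint survives in the coordinate formula only as the index order
    \<open>(k, i)\<close> with summation over the first index.\<close>
  have adj: "mat_apply n (adjoint_mat n V) y i = (\<Sum>k<n. V (k, i) * y k)" if "i < n" for V y i
    using that by (simp add: mat_apply_def adjoint_mat_def)
  show ?thesis
  proof
    assume ?L
    then obtain z where z: "\<forall>j\<in>{1..m}. z j \<in> mat_apply n (adjoint_mat n (U j)) ` polar n K"
      and x: "x = vscale n (1 / real m) (\<lambda>i\<in>{..<n}. \<Sum>j\<in>{1..m}. z j i)"
      unfolding polar_average_def dilate_def minkowski_sum_def by blast
    have "\<forall>j\<in>{1..m}. \<exists>y. y \<in> polar n K \<and> z j = mat_apply n (adjoint_mat n (U j)) y"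
      using z by blast
    then obtain y where y: "\<And>j. j \<in> {1..m} \<Longrightarrow> y j \<in> polar n K \<and> z j = mat_apply n (adjoint_mat n (U j)) (y j)"
      by metis
    then show ?R
      by (intro exI[of _ y]) (auto simp: x vscale_def adj fun_eq_iff)
  next
    assume ?R
    then obtain y where y: "\<forall>j\<in>{1..m}. y j \<in> polar n K"
      and x: "x = (\<lambda>i\<in>{..<n}. (\<Sum>j=1..m. \<Sum>k<n. U j (k, i) * y j k) / real m)" by blast
    let ?z = "\<lambda>j. mat_apply n (adjoint_mat n (U j)) (y j)"
    have "x = vscale n (1 / real m) (\<lambda>i\<in>{..<n}. \<Sum>j\<in>{1..m}. ?z j i)"
      by (auto simp: x vscale_def adj fun_eq_iff)
    moreover have "(\<lambda>i\<in>{..<n}. \<Sum>j\<in>{1..m}. ?z j i)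
        \<in> minkowski_sum n {1..m} (\<lambda>j. mat_apply n (adjoint_mat n (U j)) ` polar n K)"
      unfolding minkowski_sum_def using y by (intro CollectI exI[of _ ?z] conjI refl) blast
    ultimately show ?L
      unfolding polar_average_def dilate_def by (rule image_eqI)
  qed
qed

text \<open>The support function of the polar is bounded by the gauge of the body:
  \<open>z / t\<close> and its negative both lie in the body. Any positive \<open>t\<close> above
  the gauge of \<open>z\<close> will do, so the polar never has to be computed.\<close>

lemma dot_polar_block_body_le:
  assumes J: "J \<subseteq> {..<n}" and t: "t > 0" and y: "y \<in> polar n (block_body n J a b)"
    and z: "L2_set z J \<le> t * a" "L2_set z ({..<n} - J) \<le> t * b"
  shows "\<bar>dot n y z\<bar> \<le> t"
proof -
  have *: "c * dot n y z \<le> t" if c: "\<bar>c\<bar> = 1" for c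
  proof -
    have "vscale n (c / t) z \<in> block_body n J a b"
      using J t z c by (simp add: block_body_def L2_set_vscale field_simps)
    then have "dot n y (vscale n (c / t) z) \<le> 1" using y by (simp add: polar_def)
    moreover have "dot n y (vscale n (c / t) z) = c / t * dot n y z"
      by (simp add: dot_def sum_distrib_left mult_ac)
    ultimately show ?thesis using t by (simp add: field_simps)
  qed
  from *[of 1] *[of "-1"] show ?thesis by (simp add: abs_le_iff)
qed

text \<open>The body lies in the ball of radius \<open>sqrt (a\<^sup>2 + b\<^sup>2)\<close>;
  polarity reverses the inclusion and inverts the radius.\<close>

lemma ball_subset_polar_block_body:
  assumes J: "J \<subseteq> {..<n}" and y: "y \<in> Rn n" "L2_set y {..<n} * sqrt (a\<^sup>2 + b\<^sup>2) \<le> 1"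
  shows "y \<in> polar n (block_body n J a b)"
proof -
  have "dot n y x \<le> 1" if x: "x \<in> block_body n J a b" for x
  proof -
    have "dot n y x \<le> L2_set y {..<n} * L2_set x {..<n}"
      using abs_dot_le[of "y" x "{..<n}"] by (simp add: dot_def abs_le_iff)
    also have "\<dots> \<le> L2_set y {..<n} * sqrt (a\<^sup>2 + b\<^sup>2)"
    proof (intro mult_left_mono real_le_rsqrt)
      show "(L2_set x {..<n})\<^sup>2 \<le> a\<^sup>2 + b\<^sup>2"
        unfolding L2_set_split[OF J] using x
        by (intro add_mono power_mono) (auto simp: block_body_def)
    qed simp
    finally show ?thesis using y by simp
  qed
  then show ?thesis using y by (simp add: polar_def)
qed

text \<open>On the body a coordinate from \<open>J\<close> is at most \<open>a\<close> in absolute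
  value. These points of the polar, taken with \<open>c\<close> of size \<open>1 / a\<close>, force
  a large outer radius of the average.\<close>

lemma axis_in_polar_block_body:
  assumes J: "J \<subseteq> {..<n}" and k: "k \<in> J" and c: "\<bar>c\<bar> * a \<le> 1"
  shows "vscale n c (axis_vec n k) \<in> polar n (block_body n J a b)"
proof -
  have fin: "finite J" using J finite_subset by blast
  have "dot n (vscale n c (axis_vec n k)) x \<le> 1" if x: "x \<in> block_body n J a b" for x
  proof -
    have "dot n (vscale n c (axis_vec n k)) x = (\<Sum>i<n. if i = k then c * x i else 0)"
      unfolding dot_def by (intro sum.cong) auto
    also have "\<dots> = c * x k" using k J by (auto simp: subset_iff)
    also have "\<dots> \<le> \<bar>c\<bar> * \<bar>x k\<bar>" by (simp flip: abs_mult)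
    also have "\<dots> \<le> \<bar>c\<bar> * a"
      using abs_le_L2_set[OF fin k, of x] x by (intro mult_left_mono) (auto simp: block_body_def)
    finally show ?thesis using c by simp
  qed
  then show ?thesis by (simp add: polar_def)
qed

text \<open>Choosing each sign so that the new vector does not point against the partial sum.\<close>

lemma signed_sum_norm_ge:
  fixes w :: "'b \<Rightarrow> 'a \<Rightarrow> real"
  assumes "finite A" "\<And>j. j \<in> A \<Longrightarrow> (\<Sum>i\<in>I. (w j i)\<^sup>2) = 1"
  shows "\<exists>\<epsilon>. (\<forall>j. \<bar>\<epsilon> j\<bar> = 1) \<and> real (card A) \<le> (\<Sum>i\<in>I. (\<Sum>j\<in>A. \<epsilon> j * w j i)\<^sup>2)"
  using assms
proof (induction A rule: finite_induct)
  case empty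
  then show ?case by (intro exI[of _ "\<lambda>_. 1"]) simp
next
  case (insert a A)
  obtain \<epsilon> where \<epsilon>: "\<And>j. \<bar>\<epsilon> j\<bar> = 1" "real (card A) \<le> (\<Sum>i\<in>I. (\<Sum>j\<in>A. \<epsilon> j * w j i)\<^sup>2)"
    using insert by auto
  let ?S = "\<lambda>i. \<Sum>j\<in>A. \<epsilon> j * w j i"
  define e :: real where "e = (if (\<Sum>i\<in>I. ?S i * w a i) \<ge> 0 then 1 else -1)"
  have e: "\<bar>e\<bar> = 1" "e * (\<Sum>i\<in>I. ?S i * w a i) \<ge> 0" by (auto simp: e_def)
  have e2: "e\<^sup>2 = 1" by (simp add: e_def)
  have "(\<Sum>j\<in>insert a A. (\<epsilon>(a := e)) j * w j i) = ?S i + e * w a i" for i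
  proof -
    have "(\<Sum>j\<in>A. (\<epsilon>(a := e)) j * w j i) = ?S i"
      using insert.hyps by (intro sum.cong) auto
    then show ?thesis using insert.hyps by simp
  qed
  then have "(\<Sum>i\<in>I. (\<Sum>j\<in>insert a A. (\<epsilon>(a := e)) j * w j i)\<^sup>2)
      = (\<Sum>i\<in>I. (?S i)\<^sup>2 + 2 * (e * (?S i * w a i)) + e\<^sup>2 * (w a i)\<^sup>2)"
    by (intro sum.cong) (simp_all add: power2_sum power_mult_distrib)
  also have "\<dots> = (\<Sum>i\<in>I. (?S i)\<^sup>2) + 2 * (e * (\<Sum>i\<in>I. ?S i * w a i)) + e\<^sup>2 * (\<Sum>i\<in>I. (w a i)\<^sup>2)"
    by (simp only: sum.distrib sum_distrib_left)
  also have "\<dots> \<ge> real (card A) + 1"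
    using \<epsilon>(2) e(2) e2 insert.prems[of a] by simp
  finally have "real (card (insert a A)) \<le> (\<Sum>i\<in>I. (\<Sum>j\<in>insert a A. (\<epsilon>(a := e)) j * w j i)\<^sup>2)"
    using insert.hyps by simp
  then show ?case using \<epsilon>(1) e(1) by (intro exI[of _ "\<epsilon>(a := e)"]) auto
qed

context
  fixes n m :: nat and U :: "nat \<Rightarrow> rmat" and J :: "nat set" and a b :: real
  assumes J: "J \<subseteq> {..<n}" "J \<noteq> {}" and ab: "a > 0" "b > 0" and m: "1 \<le> m"
    and U: "\<And>j. j \<in> {1..m} \<Longrightarrow> U j \<in> orthogonal_group n"
begin

text \<open>Balls are rotation invariant: with the points \<open>U j x\<close> of the polar every
  rotated summand is \<open>x\<close>, and so is the average. Together with the next inclusion this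
  shows that the infimum defining the distance is over a nonempty set.\<close>

lemma polar_average_contains_ball:
  "dilate n (1 / sqrt (a\<^sup>2 + b\<^sup>2)) (unit_ball n) \<subseteq> polar_average n m U (block_body n J a b)"
proof
  have pos: "sqrt (a\<^sup>2 + b\<^sup>2) > 0" using ab by (simp add: add_pos_pos)
  fix x assume "x \<in> dilate n (1 / sqrt (a\<^sup>2 + b\<^sup>2)) (unit_ball n)"
  then have x: "x \<in> Rn n" "L2_set x {..<n} \<le> 1 / sqrt (a\<^sup>2 + b\<^sup>2)"
    using pos by (simp_all add: dilate_unit_ball)
  let ?y = "\<lambda>j. mat_apply n (U j) x"
  have "?y j \<in> polar n (block_body n J a b)" if j: "j \<in> {1..m}" for j
  proof (rule ball_subset_polar_block_body[OF J(1)])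
    show "?y j \<in> Rn n" by (simp add: mat_apply_def Rn_def)
    have "L2_set (?y j) {..<n} = L2_set x {..<n}"
      using orthogonal_group_isometry[OF U[OF j], of x] by (simp add: L2_set_def mat_apply_def)
    then show "L2_set (?y j) {..<n} * sqrt (a\<^sup>2 + b\<^sup>2) \<le> 1"
      using x pos by (simp add: field_simps)
  qed
  moreover have "x = (\<lambda>i\<in>{..<n}. (\<Sum>j=1..m. \<Sum>k<n. U j (k, i) * ?y j k) / real m)"
  proof
    fix i
    show "x i = (\<lambda>i\<in>{..<n}. (\<Sum>j=1..m. \<Sum>k<n. U j (k, i) * ?y j k) / real m) i"
    proof (cases "i < n")
      case True
      have "(\<Sum>j=1..m. \<Sum>k<n. U j (k, i) * ?y j k) = (\<Sum>j=1..m. x i)"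
        using orthogonal_group_adjoint_apply[OF U True, of _ x]
        by (intro sum.cong refl) (simp add: mat_apply_def)
      then show ?thesis using m True by simp
    next
      case False
      then show ?thesis using x by (auto simp: Rn_def PiE_def extensional_def)
    qed
  qed
  ultimately show "x \<in> polar_average n m U (block_body n J a b)"
    unfolding polar_average_iff by (intro exI[of _ ?y] conjI ballI)
qed

text \<open>Only finiteness matters, so each coordinate is estimated crudely, using that the entries
  of an orthogonal matrix are at most 1 in absolute value.\<close>

lemma polar_average_bounded:
  "polar_average n m U (block_body n J a b) \<subseteq> dilate n (real n * (real n * (1 / a + 1 / b))) (unit_ball n)"
proof
  let ?M = "1 / a + 1 / b"
  have n: "n > 0" using J by (cases n) auto
  have M: "?M > 0" using ab by (simp add: add_pos_pos)
  fix x assume "x \<in> polar_average n m U (block_body n J a b)"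
  then obtain y where y: "\<And>j. j \<in> {1..m} \<Longrightarrow> y j \<in> polar n (block_body n J a b)"
    and x: "x = (\<lambda>i\<in>{..<n}. (\<Sum>j=1..m. \<Sum>k<n. U j (k, i) * y j k) / real m)"
    unfolding polar_average_iff by blast
  \<comment> \<open>\<open>1 / a + 1 / b\<close> is at least the gauge of any coordinate vector,
    whichever block contains its index.\<close>
  have yM: "\<bar>y j k\<bar> \<le> ?M" if j: "j \<in> {1..m}" and k: "k < n" for j k
  proof -
    have "?M * a \<ge> 1" "?M * b \<ge> 1" using ab by (simp_all add: field_simps)
    moreover have "L2_set (axis_vec n k) I \<le> 1" if "I \<subseteq> {..<n}" for I
      using that by (simp add: L2_set_axis_vec)
    ultimately have "L2_set (axis_vec n k) J \<le> ?M * a" "L2_set (axis_vec n k) ({..<n} - J) \<le> ?M * b"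
      using J(1) by (meson order_trans Diff_subset)+
    then have "\<bar>dot n (y j) (axis_vec n k)\<bar> \<le> ?M"
      by (rule dot_polar_block_body_le[OF J(1) M y[OF j]])
    moreover have "dot n (y j) (axis_vec n k) = (\<Sum>i<n. if i = k then y j i else 0)"
      unfolding dot_def by (intro sum.cong) auto
    ultimately show ?thesis using k by simp
  qed
  have U1: "\<bar>U j (k, i)\<bar> \<le> 1" if j: "j \<in> {1..m}" and ki: "k < n" "i < n" for j k i
  proof -
    have "(U j (k, i))\<^sup>2 \<le> (\<Sum>i<n. (U j (k, i))\<^sup>2)"
      using ki by (intro member_le_sum[of i "{..<n}" "\<lambda>i. (U j (k, i))\<^sup>2"]) auto
    then show ?thesis using orthogonal_group_rows[OF U[OF j] ki(1)] by (simp add: abs_square_le_1)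
  qed
  have xi: "\<bar>x i\<bar> \<le> real n * ?M" if i: "i < n" for i
  proof -
    have "\<bar>\<Sum>j=1..m. \<Sum>k<n. U j (k, i) * y j k\<bar> \<le> (\<Sum>j=1..m. \<Sum>k<n. \<bar>U j (k, i) * y j k\<bar>)"
      by (intro order_trans[OF sum_abs] sum_mono sum_abs)
    also have "\<dots> \<le> (\<Sum>j=1..m. \<Sum>k<n. 1 * ?M)"
      unfolding abs_mult using U1 yM i M by (intro sum_mono mult_mono) auto
    also have "\<dots> = real m * (real n * ?M)" by simp
    finally show ?thesis using m i by (simp add: x field_simps)
  qed
  have "L2_set x {..<n} \<le> (\<Sum>i<n. \<bar>x i\<bar>)" by (rule L2_set_le_sum_abs)
  also have "\<dots> \<le> (\<Sum>i<n. real n * ?M)" using xi by (intro sum_mono) auto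
  finally have "L2_set x {..<n} \<le> real n * (real n * ?M)" by simp
  moreover have "real n * (real n * ?M) > 0" using n M by simp
  moreover have "x \<in> Rn n" by (simp add: x Rn_def)
  ultimately show "x \<in> dilate n (real n * (real n * ?M)) (unit_ball n)"
    by (simp add: dilate_unit_ball)
qed

text \<open>For one fixed \<open>k\<close> in \<open>J\<close>, the adjoint of \<open>U j\<close>
  sends the \<open>k\<close>-th coordinate vector to the \<open>k\<close>-th row of
  \<open>U j\<close>, a unit vector. A signed sum of \<open>m\<close> such rows has norm at least
  \<open>sqrt m\<close>, and the average divides it by \<open>a * m\<close>.\<close>

lemma polar_average_outer_radius_ge:
  assumes \<beta>: "\<beta> > 0" "polar_average n m U (block_body n J a b) \<subseteq> dilate n \<beta> (unit_ball n)"
  shows "1 / (a * sqrt (real m)) \<le> \<beta>"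
proof -
  obtain k where k: "k \<in> J" using J by blast
  then have kn: "k < n" using J by auto
  obtain \<epsilon> where \<epsilon>: "\<And>j. \<bar>\<epsilon> j\<bar> = 1"
    and ge: "real (card {1..m}) \<le> (\<Sum>i<n. (\<Sum>j=1..m. \<epsilon> j * U j (k, i))\<^sup>2)"
    using signed_sum_norm_ge[of "{1..m}" "\<lambda>j i. U j (k, i)" "{..<n}", OF _ orthogonal_group_rows[OF U kn]]
    by auto
  define y where "y = (\<lambda>j. vscale n (\<epsilon> j / a) (axis_vec n k))"
  define x where "x = (\<lambda>i\<in>{..<n}. (\<Sum>j=1..m. \<Sum>k<n. U j (k, i) * y j k) / real m)"
  have "y j \<in> polar n (block_body n J a b)" for j
    unfolding y_def using J k \<epsilon>[of j] ab by (intro axis_in_polar_block_body) auto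
  then have "x \<in> polar_average n m U (block_body n J a b)"
    unfolding polar_average_iff x_def by (intro exI[of _ y]) simp
  then have "L2_set x {..<n} \<le> \<beta>" using \<beta> by (auto simp: dilate_unit_ball)
  have xi: "x i = (\<Sum>j=1..m. \<epsilon> j * U j (k, i)) / (a * real m)" if "i < n" for i
  proof -
    have "(\<Sum>l<n. U j (l, i) * y j l) = \<epsilon> j * U j (k, i) / a" for j
    proof -
      have "(\<Sum>l<n. U j (l, i) * y j l) = (\<Sum>l<n. if l = k then \<epsilon> j * U j (l, i) / a else 0)"
        by (intro sum.cong) (auto simp: y_def)
      then show ?thesis using kn by simp
    qed
    then show ?thesis using that by (simp add: x_def sum_divide_distrib[symmetric])
  qed
  have "1 / (a * sqrt (real m)) = sqrt (real m) / (a * real m)"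
  proof -
    have "sqrt (real m) / (a * real m) = sqrt (real m) / real m / a" by simp
    also have "sqrt (real m) / real m = inverse (sqrt (real m))" by (simp add: sqrt_divide_self_eq)
    finally show ?thesis by (simp add: field_simps)
  qed
  also have "\<dots> \<le> sqrt (\<Sum>i<n. (\<Sum>j=1..m. \<epsilon> j * U j (k, i))\<^sup>2) / (a * real m)"
    using ge ab by (intro divide_right_mono real_sqrt_le_mono) auto
  also have "\<dots> = L2_set x {..<n}"
    using ab by (simp add: L2_set_def xi power_divide real_sqrt_divide flip: sum_divide_distrib)
  also have "\<dots> \<le> \<beta>" by fact
  finally show ?thesis .
qed

text \<open>The support function of the average at the coordinate vector \<open>e\<^sub>i\<close> is at most the mean over
  \<open>j\<close> of \<open>\<bar>P U\<^sub>j e\<^sub>i\<bar> / a + 1 / b\<close>, with \<open>P\<close> the projection to the block \<open>J\<close>; averaged over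
  \<open>i\<close>, the squares \<open>\<bar>P U\<^sub>j e\<^sub>i\<bar>\<^sup>2\<close> have mean \<open>card J / n\<close>.\<close>

lemma polar_average_inner_radius_le:
  assumes r: "r > 0" "dilate n r (unit_ball n) \<subseteq> polar_average n m U (block_body n J a b)"
  shows "r \<le> sqrt (real (card J) / real n) / a + 1 / b"
proof -
  have n: "n > 0" using J by (cases n) auto
  define q where "q = sqrt (real (card J) / real n)"
  define u where "u = (\<lambda>j i. L2_set (\<lambda>k. U j (k, i)) J)"
  have u0: "u j i \<ge> 0" for j i by (simp add: u_def)
  have sumu: "(\<Sum>i<n. u j i) \<le> real n * q" if j: "j \<in> {1..m}" for j
  proof -
    \<comment> \<open>Cauchy-Schwarz over \<open>i\<close>. After exchanging the sums, the squares
      add up to \<open>card J\<close>, because the rows with index in \<open>J\<close> are unit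
      vectors.\<close>
    have "(\<Sum>i<n. \<bar>u j i\<bar> * \<bar>1\<bar>) \<le> L2_set (u j) {..<n} * L2_set (\<lambda>_. 1) {..<n}"
      by (rule L2_set_mult_ineq)
    also have "(\<Sum>i<n. (u j i)\<^sup>2) = (\<Sum>i<n. \<Sum>k\<in>J. (U j (k, i))\<^sup>2)"
      by (simp add: u_def L2_set_def sum_nonneg)
    then have "L2_set (u j) {..<n} = sqrt (\<Sum>k\<in>J. \<Sum>i<n. (U j (k, i))\<^sup>2)"
      unfolding L2_set_def by (simp add: sum.swap[of _ J])
    also have "(\<Sum>k\<in>J. \<Sum>i<n. (U j (k, i))\<^sup>2) = (\<Sum>k\<in>J. 1)"
      using J by (intro sum.cong orthogonal_group_rows[OF U[OF j]]) auto
    also have "sqrt (\<Sum>k\<in>J. 1) * L2_set (\<lambda>_. 1) {..<n} = sqrt (real (card J)) * (real n / sqrt (real n))"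
      by (simp add: L2_set_constant real_div_sqrt)
    also have "\<dots> = real n * q" by (simp add: q_def real_sqrt_divide)
    finally show ?thesis using u0 by simp
  qed
  \<comment> \<open>Some coordinate direction is no worse than the mean over all of them. The sum
    over \<open>j\<close> is kept inside because a single direction \<open>i\<close> has to serve
    all rotations at once.\<close>
  have "\<exists>i<n. (\<Sum>j=1..m. u j i) \<le> real m * q"
  proof (rule ccontr)
    assume "\<not> ?thesis"
    then have "(\<Sum>i<n. real m * q) < (\<Sum>i<n. \<Sum>j=1..m. u j i)"
      using n by (intro sum_strict_mono) auto
    also have "\<dots> = (\<Sum>j=1..m. \<Sum>i<n. u j i)" by (rule sum.swap)
    also have "\<dots> \<le> (\<Sum>j=1..m. real n * q)" by (intro sum_mono sumu)
    finally show False by simp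
  qed
  then obtain i where i: "i < n" "(\<Sum>j=1..m. u j i) \<le> real m * q" by blast
  have "vscale n r (axis_vec n i) \<in> dilate n r (unit_ball n)"
    using r i by (simp add: dilate_unit_ball L2_set_vscale L2_set_axis_vec)
  then have "vscale n r (axis_vec n i) \<in> polar_average n m U (block_body n J a b)" using r by blast
  then obtain y where y: "\<And>j. j \<in> {1..m} \<Longrightarrow> y j \<in> polar n (block_body n J a b)"
    and x: "vscale n r (axis_vec n i) = (\<lambda>i\<in>{..<n}. (\<Sum>j=1..m. \<Sum>k<n. U j (k, i) * y j k) / real m)"
    unfolding polar_average_iff by blast
  \<comment> \<open>Reading off the coordinate \<open>i\<close> pairs each \<open>y j\<close> with
    the \<open>i\<close>-th column of \<open>U j\<close>, whose gauge is at most
    \<open>u j i / a + 1 / b\<close>.\<close>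
  have "r = vscale n r (axis_vec n i) i" using i by simp
  also have "\<dots> = (\<Sum>j=1..m. dot n (y j) (\<lambda>k. U j (k, i))) / real m"
    using i by (simp add: x dot_def mult.commute)
  also have "\<dots> \<le> (\<Sum>j=1..m. u j i / a + 1 / b) / real m"
  proof (intro divide_right_mono sum_mono)
    fix j assume j: "j \<in> {1..m}"
    have "L2_set (\<lambda>k. U j (k, i)) ({..<n} - J) \<le> L2_set (\<lambda>k. U j (k, i)) {..<n}"
      by (intro L2_set_mono_subset) auto
    also have "\<dots> = 1"
      using orthogonal_group_columns[OF U[OF j] i(1) i(1)] by (simp add: L2_set_def power2_eq_square)
    finally have 1: "L2_set (\<lambda>k. U j (k, i)) ({..<n} - J) \<le> 1" .
    have "\<bar>dot n (y j) (\<lambda>k. U j (k, i))\<bar> \<le> u j i / a + 1 / b"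
    proof (rule dot_polar_block_body_le[OF J(1) _ y[OF j]])
      show "0 < u j i / a + 1 / b" using u0[of j i] ab by (intro add_nonneg_pos) auto
      show "L2_set (\<lambda>k. U j (k, i)) J \<le> (u j i / a + 1 / b) * a"
        using ab by (simp add: u_def distrib_right)
      show "L2_set (\<lambda>k. U j (k, i)) ({..<n} - J) \<le> (u j i / a + 1 / b) * b"
        using 1 ab u0[of j i] by (simp add: distrib_right add_increasing)
    qed
    then show "dot n (y j) (\<lambda>k. U j (k, i)) \<le> u j i / a + 1 / b" by linarith
  qed simp
  also have "\<dots> = ((\<Sum>j=1..m. u j i) / a + real m * (1 / b)) / real m"
    by (simp add: sum.distrib sum_divide_distrib)
  also have "\<dots> \<le> (real m * q / a + real m * (1 / b)) / real m"
    using i ab by (intro divide_right_mono add_right_mono) auto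
  also have "\<dots> = q / a + 1 / b" using m by (simp add: add_divide_distrib)
  finally show ?thesis by (simp add: q_def)
qed

text \<open>In the product of the outer bound \<open>1 / (a * sqrt m)\<close> with the reciprocal of
  the inner bound \<open>(q + a / b) / a\<close> the factor \<open>a\<close> cancels. The bound 1
  only expresses that nested balls have ordered radii.\<close>

lemma geom_dist_polar_average_ge:
  "max 1 (1 / (sqrt (real m) * (sqrt (real (card J) / real n) + a / b)))
    \<le> geom_dist n (polar_average n m U (block_body n J a b)) (unit_ball n)"
  unfolding geom_dist_def
proof (rule cInf_greatest)
  let ?L = "polar_average n m U (block_body n J a b)"
  let ?S = "{\<alpha> * \<beta> |\<alpha> \<beta>. 0 < \<alpha> \<and> 0 < \<beta> \<and> dilate n (1 / \<alpha>) (unit_ball n) \<subseteq> ?L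
    \<and> ?L \<subseteq> dilate n \<beta> (unit_ball n)}"
  have n: "n > 0" using J by (cases n) auto
  have pos: "sqrt (a\<^sup>2 + b\<^sup>2) > 0" "real n * (real n * (1 / a + 1 / b)) > 0"
    using ab n by (auto simp: add_pos_pos)
  show "?S \<noteq> {}"
    using pos polar_average_contains_ball polar_average_bounded by blast
  fix d assume "d \<in> ?S"
  then obtain \<alpha> \<beta> where d: "d = \<alpha> * \<beta>" and \<alpha>: "0 < \<alpha>" "dilate n (1 / \<alpha>) (unit_ball n) \<subseteq> ?L"
    and \<beta>: "0 < \<beta>" "?L \<subseteq> dilate n \<beta> (unit_ball n)" by blast
  \<comment> \<open>A coordinate vector of length \<open>1 / \<alpha>\<close> lies in the inner
    ball, hence in the outer one.\<close>
  have "vscale n (1 / \<alpha>) (axis_vec n 0) \<in> dilate n (1 / \<alpha>) (unit_ball n)"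
    using \<alpha> n by (simp add: dilate_unit_ball L2_set_vscale L2_set_axis_vec)
  then have "vscale n (1 / \<alpha>) (axis_vec n 0) \<in> dilate n \<beta> (unit_ball n)" using \<alpha> \<beta> by blast
  then have "1 / \<alpha> \<le> \<beta>"
    using \<alpha> \<beta> n by (simp add: dilate_unit_ball L2_set_vscale L2_set_axis_vec)
  then have d1: "1 \<le> d" using \<alpha> by (simp add: d field_simps)
  define q where "q = sqrt (real (card J) / real n)"
  have q: "q \<ge> 0" by (simp add: q_def)
  have "1 / \<alpha> \<le> q / a + 1 / b"
    using polar_average_inner_radius_le[of "1 / \<alpha>"] \<alpha> by (simp add: q_def)
  also have "q / a + 1 / b = (q + a / b) / a" using ab by (simp add: field_simps)
  finally have 1: "a \<le> \<alpha> * (q + a / b)" using \<alpha> ab by (simp add: field_simps)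
  have 2: "1 \<le> \<beta> * (a * sqrt (real m))"
    using polar_average_outer_radius_ge[OF \<beta>] ab m by (simp add: field_simps)
  have qp: "q + a / b > 0" using q ab by (intro add_nonneg_pos) auto
  have "1 \<le> \<beta> * (a * sqrt (real m))" by (rule 2)
  also have "\<dots> \<le> \<beta> * ((\<alpha> * (q + a / b)) * sqrt (real m))"
    using 1 \<beta> by (intro mult_left_mono mult_right_mono) auto
  also have "\<dots> = d * (sqrt (real m) * (q + a / b))" by (simp add: d)
  finally have "1 / (sqrt (real m) * (q + a / b)) \<le> d"
    using qp m by (subst pos_divide_le_eq) auto
  with d1 show "max 1 (1 / (sqrt (real m) * (sqrt (real (card J) / real n) + a / b))) \<le> d"
    by (simp add: q_def)
qed

end

section \<open>The normalised bodies\<close>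

definition norm_factor :: "nat \<Rightarrow> nat \<Rightarrow> real" where
  "norm_factor n s = vol n (Z_body n s) powr (- 1 / real n)"

lemma Z_body_eq_block_body:
  assumes "s \<le> n"
  shows "Z_body n s = block_body n {..<s} (sqrt (real s + 2)) (sqrt (real (n - s) + 2))"
proof -
  have "{..<n} - {..<s} = {s..<n}" using assms by auto
  then show ?thesis by (simp add: Z_body_def block_body_def L2_set_def)
qed

lemma admissible_le: "admissible n s \<Longrightarrow> 2 \<le> n \<and> 1 \<le> s \<and> 2 * s \<le> n"
  by (auto simp: admissible_def)

text \<open>Bounds the \<open>n\<close>-th root of the volume of \<open>Z_body\<close>: in the
  Gaussian comparison the squared radii add up to \<open>n + 4\<close>, which is at most
  \<open>3 * n\<close> for \<open>n \<ge> 2\<close>.\<close>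

abbreviation vol_bound :: real where
  "vol_bound \<equiv> exp (3 / 2) * sqrt (2 * pi)"

lemma vol_Z_body_bounds:
  assumes "admissible n s"
  shows "2 ^ n \<le> vol n (Z_body n s)" "vol n (Z_body n s) \<le> vol_bound ^ n"
proof -
  have s: "2 \<le> n" "1 \<le> s" "2 * s \<le> n" using admissible_le[OF assms] by auto
  have Z: "Z_body n s = block_body n {..<s} (sqrt (real s + 2)) (sqrt (real (n - s) + 2))"
    using s by (intro Z_body_eq_block_body) simp
  show "2 ^ n \<le> vol n (Z_body n s)"
    unfolding Z using s by (intro vol_block_body_ge) auto
  have "vol n (Z_body n s) \<le> exp (((sqrt (real s + 2))\<^sup>2 + (sqrt (real (n - s) + 2))\<^sup>2) / 2) * sqrt (2 * pi) ^ n"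
    unfolding Z using s by (intro vol_block_body_le) auto
  also have "((sqrt (real s + 2))\<^sup>2 + (sqrt (real (n - s) + 2))\<^sup>2) / 2 = (real n + 4) / 2"
    using s by simp
  also have "exp ((real n + 4) / 2) \<le> exp (real n * (3 / 2))"
    using s by simp
  also have "exp (real n * (3 / 2)) = exp (3 / 2) ^ n"
    by (rule exp_of_nat_mult)
  finally show "vol n (Z_body n s) \<le> vol_bound ^ n"
    by (simp add: power_mult_distrib mult_right_mono)
qed

lemma norm_factor_bounds:
  assumes "admissible n s"
  shows "1 / vol_bound \<le> norm_factor n s" "norm_factor n s \<le> 1 / 2"
    "norm_factor n s ^ n * vol n (Z_body n s) = 1"
proof -
  let ?V = "vol n (Z_body n s)"
  have n: "n > 0" using admissible_le[OF assms] by simp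
  note V = vol_Z_body_bounds[OF assms]
  have V0: "?V > 0" using V(1) by (rule less_le_trans[rotated]) simp
  have root: "(c ^ n) powr (- 1 / real n) = 1 / c" if "c > 0" for c :: real
    using that n by (simp add: powr_powr powr_minus_divide flip: powr_realpow)
  have "(vol_bound ^ n) powr (- 1 / real n) \<le> ?V powr (- 1 / real n)"
    using V V0 by (intro powr_mono2') auto
  then show "1 / vol_bound \<le> norm_factor n s"
    by (subst (asm) root) (auto simp: norm_factor_def)
  have "?V powr (- 1 / real n) \<le> (2 ^ n) powr (- 1 / real n)"
    using V V0 by (intro powr_mono2') auto
  then show "norm_factor n s \<le> 1 / 2"
    by (subst (asm) root) (auto simp: norm_factor_def)
  have "norm_factor n s ^ n = ?V powr (- 1 / real n * real n)"
    using V0 by (simp add: norm_factor_def powr_powr flip: powr_realpow)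
  also have "\<dots> = 1 / ?V"
    using n V0 by (simp add: powr_minus_divide)
  finally show "norm_factor n s ^ n * vol n (Z_body n s) = 1"
    using V0 by simp
qed

lemma vol_bound_ge_1: "vol_bound \<ge> 1"
proof -
  have "exp (3 / 2 :: real) \<ge> 1" "sqrt (2 * pi) \<ge> 1"
    using pi_gt3 by simp_all
  then show ?thesis using mult_mono[of 1 "exp (3/2 :: real)" 1 "sqrt (2 * pi)"] by simp
qed

lemma norm_factor_pos: "admissible n s \<Longrightarrow> norm_factor n s > 0"
  using norm_factor_bounds(1)[of n s] by (rule less_le_trans[rotated]) auto

definition radius_fst :: "nat \<Rightarrow> nat \<Rightarrow> real" where
  "radius_fst n s = norm_factor n s * sqrt (real s + 2)"

definition radius_snd :: "nat \<Rightarrow> nat \<Rightarrow> real" where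
  "radius_snd n s = norm_factor n s * sqrt (real (n - s) + 2)"

lemma K_body_eq_block_body:
  assumes "admissible n s"
  shows "K_body n s = block_body n {..<s} (radius_fst n s) (radius_snd n s)"
proof -
  have s: "s \<le> n" using admissible_le[OF assms] by simp
  have "K_body n s = dilate n (norm_factor n s) (block_body n {..<s} (sqrt (real s + 2)) (sqrt (real (n - s) + 2)))"
    by (simp add: K_body_def norm_factor_def Z_body_eq_block_body[OF s])
  also have "\<dots> = block_body n {..<s} (radius_fst n s) (radius_snd n s)"
    using s norm_factor_pos[OF assms] by (simp add: dilate_block_body radius_fst_def radius_snd_def)
  finally show ?thesis .
qed

text \<open>The numerical factors are perfect squares chosen to absorb the bound 1 / 2 for
  \<open>norm_factor\<close>: \<open>s + 2 \<le> 4 * s\<close>, \<open>(n + 4) / 4 \<le> n\<close>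
  and \<open>n / 4 \<le> n - s + 2\<close>.\<close>

lemma radius_bounds:
  assumes "admissible n s"
  shows "0 < radius_fst n s" "radius_fst n s \<le> radius_snd n s"
    "1 / vol_bound * sqrt (real s) \<le> radius_fst n s" "radius_fst n s \<le> sqrt (real s)"
    "(radius_fst n s)\<^sup>2 + (radius_snd n s)\<^sup>2 \<le> real n"
    "1 / (2 * vol_bound) * sqrt (real n) \<le> radius_snd n s"
proof -
  let ?l = "norm_factor n s"
  have s: "2 \<le> n" "1 \<le> s" "2 * s \<le> n" using admissible_le[OF assms] by auto
  note l = norm_factor_bounds(1,2)[OF assms] norm_factor_pos[OF assms]
  show "0 < radius_fst n s" using l by (simp add: radius_fst_def)
  show "radius_fst n s \<le> radius_snd n s"
    unfolding radius_fst_def radius_snd_def using s l by (intro mult_left_mono) auto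
  show "1 / vol_bound * sqrt (real s) \<le> radius_fst n s"
    unfolding radius_fst_def using l by (intro mult_mono) auto
  have "?l * sqrt (real s + 2) \<le> 1 / 2 * sqrt (4 * real s)"
    using s l by (intro mult_mono) auto
  also have "\<dots> = sqrt (real s)" by (simp add: real_sqrt_mult)
  finally show "radius_fst n s \<le> sqrt (real s)" by (simp add: radius_fst_def)
  have "(radius_fst n s)\<^sup>2 + (radius_snd n s)\<^sup>2 = ?l\<^sup>2 * (real n + 4)"
    using s by (simp add: radius_fst_def radius_snd_def power_mult_distrib algebra_simps of_nat_diff)
  also have "\<dots> \<le> (1 / 2)\<^sup>2 * (real n + 4)"
    using l by (intro mult_right_mono power_mono) auto
  also have "\<dots> \<le> real n" using s by (simp add: power2_eq_square)
  finally show "(radius_fst n s)\<^sup>2 + (radius_snd n s)\<^sup>2 \<le> real n" .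
  have "1 / 2 * sqrt (real n) = sqrt (real n / 4)"
    by (simp add: real_sqrt_divide)
  also have "\<dots> \<le> sqrt (real (n - s) + 2)" using s by (simp add: of_nat_diff)
  finally have "1 / vol_bound * (1 / 2 * sqrt (real n)) \<le> radius_snd n s"
    unfolding radius_snd_def using l by (intro mult_mono) auto
  then show "1 / (2 * vol_bound) * sqrt (real n) \<le> radius_snd n s" by simp
qed

lemma block_nonempty:
  assumes "admissible n s"
  shows "{..<s} \<subseteq> {..<n}" "{..<s} \<noteq> {}"
proof -
  show "{..<s} \<subseteq> {..<n}" using admissible_le[OF assms] by auto
  have "0 \<in> {..<s}" using admissible_le[OF assms] by simp
  then show "{..<s} \<noteq> {}" by blast
qed

lemma symmetric_K_body: "admissible n s \<Longrightarrow> symmetric n (K_body n s)"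
  by (simp add: K_body_eq_block_body symmetric_block_body[OF block_nonempty(1)])

lemma isotropic_K_body:
  assumes "admissible n s"
  shows "isotropic n (K_body n s)"
  unfolding K_body_eq_block_body[OF assms]
proof (rule isotropic_block_body[OF block_nonempty(1)[OF assms] norm_factor_pos[OF assms]])
  have s: "s \<le> n" using admissible_le[OF assms] by simp
  have "vol n (block_body n {..<s} (radius_fst n s) (radius_snd n s))
      = norm_factor n s ^ s * norm_factor n s ^ (n - s) * vol n (Z_body n s)"
    using vol_block_body_scale[OF block_nonempty(1)[OF assms] norm_factor_pos[OF assms] norm_factor_pos[OF assms]]
    by (simp add: radius_fst_def radius_snd_def Z_body_eq_block_body[OF s])
  also have "norm_factor n s ^ s * norm_factor n s ^ (n - s) = norm_factor n s ^ n"
    using s by (simp flip: power_add)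
  finally show "vol n (block_body n {..<s} (radius_fst n s) (radius_snd n s)) = 1"
    using norm_factor_bounds(3)[OF assms] by simp
qed (simp_all add: radius_fst_def radius_snd_def)

lemma inradius_K_body: "admissible n s \<Longrightarrow> inradius n (K_body n s) = radius_fst n s"
  using radius_bounds(1,2) block_nonempty
  by (simp add: K_body_eq_block_body inradius_block_body)

lemma gauge_max_K_body: "admissible n s \<Longrightarrow> gauge_max n (K_body n s) = 1 / radius_fst n s"
  using radius_bounds(1,2) block_nonempty
  by (simp add: K_body_eq_block_body gauge_max_block_body)

text \<open>The lower bound uses that the squared radii add up to at most \<open>n\<close>. In the
  upper one the block of radius \<open>radius_fst\<close> contributes \<open>vol_bound\<close> and
  the other \<open>2 * vol_bound\<close>, whence the factor 3.\<close>

lemma gauge_mean_K_body: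
  assumes adm: "admissible n s" and \<sigma>: "sphere_measure n \<sigma>"
  shows "1 / sqrt (real n) \<le> gauge_mean n \<sigma> (K_body n s)"
    and "gauge_mean n \<sigma> (K_body n s) \<le> (3 * vol_bound) * (1 / sqrt (real n))"
proof -
  let ?a = "radius_fst n s" and ?b = "radius_snd n s"
  have s: "2 \<le> n" "1 \<le> s" "2 * s \<le> n" using admissible_le[OF adm] by auto
  note r = radius_bounds[OF adm]
  have b0: "0 < ?b" using r by linarith
  note g = sphere_measure_gauge_block_body[OF \<sigma> block_nonempty[OF adm] r(1) b0]
  have "0 < ?a\<^sup>2 + ?b\<^sup>2" using r(1) by (simp add: add_pos_nonneg)
  then have "1 / sqrt (real n) \<le> 1 / sqrt (?a\<^sup>2 + ?b\<^sup>2)"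
    using r(5) by (intro frac_le) auto
  with g(1) show "1 / sqrt (real n) \<le> gauge_mean n \<sigma> (K_body n s)"
    by (simp add: K_body_eq_block_body[OF adm])
  have "sqrt (real s / real n) / ?a \<le> sqrt (real s / real n) / (1 / vol_bound * sqrt (real s))"
    using r(1,3) s by (intro divide_left_mono mult_pos_pos) auto
  also have "\<dots> = vol_bound * (1 / sqrt (real n))"
    using s by (simp add: real_sqrt_divide)
  finally have 1: "sqrt (real s / real n) / ?a \<le> vol_bound * (1 / sqrt (real n))" .
  have "1 / ?b \<le> 1 / (1 / (2 * vol_bound) * sqrt (real n))"
    using r(6) b0 s by (intro divide_left_mono mult_pos_pos) auto
  also have "\<dots> = (2 * vol_bound) * (1 / sqrt (real n))" by simp
  finally have "1 / ?b \<le> (2 * vol_bound) * (1 / sqrt (real n))" .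
  with 1 g(2) show "gauge_mean n \<sigma> (K_body n s) \<le> (3 * vol_bound) * (1 / sqrt (real n))"
    by (simp add: K_body_eq_block_body[OF adm])
qed

text \<open>The normalising factor cancels in the ratio of the radii, which is at most
  \<open>3 * q\<close>; then \<open>q + 3 * q = 4 * q\<close> accounts for the constant 1 /
  4.\<close>

lemma geom_dist_K_body_ge:
  assumes adm: "admissible n s" and m: "1 \<le> m" and U: "\<forall>j\<in>{1..m}. U j \<in> orthogonal_group n"
  shows "1 / 4 * max 1 (sqrt (real n / (real s * real m)))
    \<le> geom_dist n (polar_average n m U (K_body n s)) (unit_ball n)"
proof -
  let ?a = "radius_fst n s" and ?b = "radius_snd n s"
  have s: "2 \<le> n" "1 \<le> s" "2 * s \<le> n" using admissible_le[OF adm] by auto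
  note r = radius_bounds[OF adm]
  have b0: "0 < ?b" using r by linarith
  define q where "q = sqrt (real s / real n)"
  have q: "q > 0" using s by (simp add: q_def)
  have "?a / ?b = sqrt ((real s + 2) / (real (n - s) + 2))"
    using norm_factor_pos[OF adm] by (simp add: radius_fst_def radius_snd_def real_sqrt_divide)
  also have "\<dots> \<le> sqrt (9 * (real s / real n))"
  proof (rule real_sqrt_le_mono)
    \<comment> \<open>This uses \<open>s + 2 \<le> 3 * s\<close> and
      \<open>n - s + 2 \<ge> n / 2\<close>. The resulting factor 6 is rounded up to the square
      9.\<close>
    have "(real s + 2) / (real (n - s) + 2) \<le> (3 * real s) / (real n / 2)"
      using s by (intro frac_le) (auto simp: of_nat_diff)
    also have "\<dots> \<le> 9 * (real s / real n)" using s by (simp add: field_simps)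
    finally show "(real s + 2) / (real (n - s) + 2) \<le> 9 * (real s / real n)" .
  qed
  also have "\<dots> = 3 * q" unfolding q_def real_sqrt_mult by simp
  finally have "q + ?a / ?b \<le> 4 * q" by simp
  then have "1 / (sqrt (real m) * (4 * q)) \<le> 1 / (sqrt (real m) * (q + ?a / ?b))"
    using m q b0 r(1) by (intro divide_left_mono mult_left_mono mult_pos_pos add_pos_pos divide_pos_pos) auto
  moreover have "1 / (sqrt (real m) * (4 * q)) = 1 / 4 * sqrt (real n / (real s * real m))"
    using s m by (simp add: q_def real_sqrt_divide real_sqrt_mult)
  moreover have "max 1 (1 / (sqrt (real m) * (q + ?a / ?b)))
    \<le> geom_dist n (polar_average n m U (K_body n s)) (unit_ball n)"
    using geom_dist_polar_average_ge[OF block_nonempty[OF adm] r(1) b0 m, of U] U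
    by (simp add: K_body_eq_block_body[OF adm] q_def)
  ultimately show ?thesis by simp
qed

text \<open>The event supplied by (G) also serves for the lower bound, which holds for all
  orthogonal matrices and hence at every point of that event.\<close>

lemma averaging_two_sided:
  assumes "global_averaging_estimate k0"
  shows "\<exists>c>0. \<exists>c1>0. \<exists>C1>0. \<forall>n s m \<mu>. admissible n s \<and> k0 \<le> m \<and> haar_orthogonal n \<mu> \<longrightarrow>
     holds_with_prob (haar_power m \<mu>) (1 - exp (- c * real n))
       (\<lambda>U. c1 * max 1 (sqrt (real n / (real s * real m)))
              \<le> geom_dist n (polar_average n m U (K_body n s)) (unit_ball n) \<and>
            geom_dist n (polar_average n m U (K_body n s)) (unit_ball n)
              \<le> C1 * max 1 (sqrt (real n / (real s * real m))))"
proof -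
  obtain c C where k0: "2 \<le> k0" and cC: "c > 0" "C > 0" and
    est: "\<And>n K k \<mu>. n \<ge> 1 \<Longrightarrow> isotropic n K \<Longrightarrow> symmetric n K \<Longrightarrow> k \<ge> k0 \<Longrightarrow> haar_orthogonal n \<mu> \<Longrightarrow>
       holds_with_prob (haar_power k \<mu>) (1 - exp (- c * real n))
         (\<lambda>U. geom_dist n (polar_average n k U K) (unit_ball n)
                \<le> C * max 1 (1 / inradius n K * sqrt (real n / real k)))"
    using assms unfolding global_averaging_estimate_def by metis
  have "holds_with_prob (haar_power m \<mu>) (1 - exp (- c * real n))
       (\<lambda>U. 1 / 4 * max 1 (sqrt (real n / (real s * real m)))
              \<le> geom_dist n (polar_average n m U (K_body n s)) (unit_ball n) \<and>
            geom_dist n (polar_average n m U (K_body n s)) (unit_ball n)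
              \<le> C * vol_bound * max 1 (sqrt (real n / (real s * real m))))"
    if adm: "admissible n s" and m: "k0 \<le> m" and \<mu>: "haar_orthogonal n \<mu>" for n s m \<mu>
  proof -
    have s: "2 \<le> n" "1 \<le> s" "2 * s \<le> n" using admissible_le[OF adm] by auto
    note r = radius_bounds[OF adm]
    have m1: "1 \<le> m" using m k0 by simp
    have "1 / radius_fst n s \<le> 1 / (1 / vol_bound * sqrt (real s))"
      using r(1,3) s by (intro divide_left_mono mult_pos_pos) auto
    also have "\<dots> = vol_bound / sqrt (real s)" by simp
    finally have "1 / radius_fst n s * sqrt (real n / real m) \<le> vol_bound / sqrt (real s) * sqrt (real n / real m)"
      by (rule mult_right_mono) simp
    also have "\<dots> = vol_bound * sqrt (real n / (real s * real m))"
      by (simp add: real_sqrt_divide real_sqrt_mult)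
    also have "\<dots> \<le> vol_bound * max 1 (sqrt (real n / (real s * real m)))"
      by (intro mult_left_mono) auto
    finally have "1 / radius_fst n s * sqrt (real n / real m) \<le> vol_bound * max 1 (sqrt (real n / (real s * real m)))" .
    moreover have "1 * 1 \<le> vol_bound * max 1 (sqrt (real n / (real s * real m)))"
      using vol_bound_ge_1 by (intro mult_mono) auto
    ultimately have "max 1 (1 / radius_fst n s * sqrt (real n / real m))
        \<le> vol_bound * max 1 (sqrt (real n / (real s * real m)))" by simp
    then have up: "C * max 1 (1 / radius_fst n s * sqrt (real n / real m))
        \<le> C * vol_bound * max 1 (sqrt (real n / (real s * real m)))"
      using cC by (simp only: mult.assoc mult_le_cancel_left_pos)
    obtain E where E: "E \<in> sets (haar_power m \<mu>)" "1 - exp (- c * real n) \<le> measure (haar_power m \<mu>) E"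
      and le: "\<And>U. U \<in> E \<Longrightarrow> geom_dist n (polar_average n m U (K_body n s)) (unit_ball n)
                \<le> C * max 1 (1 / inradius n (K_body n s) * sqrt (real n / real m))"
      using est[OF _ isotropic_K_body[OF adm] symmetric_K_body[OF adm] m \<mu>] s
      unfolding holds_with_prob_def by auto
    \<comment> \<open>The deterministic bound asks for orthogonal matrices; points of an event lie
      in the product space, whose factors are the orthogonal group.\<close>
    have "\<forall>j\<in>{1..m}. U j \<in> orthogonal_group n" if "U \<in> E" for U
    proof -
      have "U \<in> space (haar_power m \<mu>)" using that E(1) sets.sets_into_space by blast
      then show ?thesis using \<mu> by (auto simp: space_PiM haar_orthogonal_def)
    qed
    then show ?thesis
      unfolding holds_with_prob_def using E le up geom_dist_K_body_ge[OF adm m1]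
      by (intro bexI[of _ E] conjI ballI) (auto simp: inradius_K_body[OF adm] intro: order_trans)
  qed
  then show ?thesis
    using cC vol_bound_ge_1
    by (intro exI[of _ c] exI[of _ "1 / 4 :: real"] exI[of _ "C * vol_bound"] conjI allI impI) auto
qed

section \<open>Optimality of the threshold\<close>

lemma threshold_sufficient_of_estimate:
  assumes "global_averaging_estimate k0"
  shows "threshold_sufficient k0"
proof -
  obtain c C where k0: "2 \<le> k0" and cC: "c > 0" "C > 0" and
    est: "\<And>n K k \<mu>. n \<ge> 1 \<Longrightarrow> isotropic n K \<Longrightarrow> symmetric n K \<Longrightarrow> k \<ge> k0 \<Longrightarrow> haar_orthogonal n \<mu> \<Longrightarrow>
       holds_with_prob (haar_power k \<mu>) (1 - exp (- c * real n))
         (\<lambda>U. geom_dist n (polar_average n k U K) (unit_ball n)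
                \<le> C * max 1 (1 / inradius n K * sqrt (real n / real k)))"
    using assms unfolding global_averaging_estimate_def by metis
  \<comment> \<open>The threshold constant 1 already makes the inner maximum equal to 1. The bound
    is \<open>max 1 C\<close> because the definition demands \<open>D \<ge> 1\<close>.\<close>
  have "holds_with_prob (haar_power k \<mu>) (1 - exp (- c * real n))
      (\<lambda>U. geom_dist n (polar_average n k U K) (unit_ball n) \<le> max 1 C)"
    if n: "n \<ge> 1" and K: "isotropic n K" "symmetric n K" and k: "k \<ge> k0"
      and kn: "real k \<ge> 1 * (real n / (inradius n K)\<^sup>2)" and \<mu>: "haar_orthogonal n \<mu>" for n K k \<mu>
  proof -
    let ?r = "inradius n K"
    have k1: "real k > 0" using k k0 by simp
    have "1 / ?r * sqrt (real n / real k) \<le> 1"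
    proof (cases "?r > 0")
      case True
      have "real n / real k \<le> ?r\<^sup>2" using kn True k1 by (simp add: field_simps)
      then have "sqrt (real n / real k) \<le> sqrt (?r\<^sup>2)" by (rule real_sqrt_le_mono)
      then show ?thesis using True by (simp add: field_simps)
    next
      \<comment> \<open>A nonpositive value of \<open>inradius\<close> makes the product
        nonpositive; for the value 0 this rests on \<open>1 / 0 = 0\<close>.\<close>
      case False
      then have "1 / ?r * sqrt (real n / real k) \<le> 0"
        by (intro mult_nonpos_nonneg) (auto simp: divide_le_0_iff)
      then show ?thesis by simp
    qed
    then have "C * max 1 (1 / ?r * sqrt (real n / real k)) \<le> max 1 C" by (simp add: max_def)
    then show ?thesis
      using est[OF n K k \<mu>] unfolding holds_with_prob_def by (meson order_trans)
  qed
  then show ?thesis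
    unfolding threshold_sufficient_def using cC(1)
    by (intro exI[of _ "1::real"] exI[of _ "max 1 C"] exI[of _ c] conjI allI impI) auto
qed

text \<open>\<open>s\<close> is the floor of \<open>\<rho>\<^sup>2\<close> clipped to the admissible
  range. Clipping below at 1 costs \<open>1 / a\<^sup>2\<close>, since
  \<open>\<rho> \<ge> a\<close>; clipping above at \<open>n div 2\<close> costs
  \<open>3 * A\<^sup>2\<close>; the floor costs a factor 2.\<close>

lemma admissible_sqrt_comparable:
  fixes a A \<rho> :: real
  assumes a: "a > 0" and A: "A > 0" and n: "2 \<le> n" and \<rho>: "a \<le> \<rho>" "\<rho> \<le> A * sqrt (real n)"
  shows "\<exists>s. admissible n s \<and> \<rho>\<^sup>2 / max 2 (3 * A\<^sup>2) \<le> real s \<and> real s \<le> max 1 (1 / a\<^sup>2) * \<rho>\<^sup>2"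
proof -
  define s where "s = max 1 (min (n div 2) (nat \<lfloor>\<rho>\<^sup>2\<rfloor>))"
  let ?D = "max 2 (3 * A\<^sup>2)"
  have "2 * s \<le> n" "1 \<le> s" using n by (auto simp: s_def)
  then have "admissible n s" using n by (simp add: admissible_def)
  moreover have "real s \<le> max 1 (1 / a\<^sup>2) * \<rho>\<^sup>2"
  proof -
    have "a\<^sup>2 \<le> \<rho>\<^sup>2" using a \<rho> by (intro power_mono) auto
    then have "1 \<le> 1 / a\<^sup>2 * \<rho>\<^sup>2" using a by (simp add: field_simps)
    also have "\<dots> \<le> max 1 (1 / a\<^sup>2) * \<rho>\<^sup>2" by (intro mult_right_mono) auto
    finally have 1: "1 \<le> max 1 (1 / a\<^sup>2) * \<rho>\<^sup>2" .
    have "real (nat \<lfloor>\<rho>\<^sup>2\<rfloor>) \<le> 1 * \<rho>\<^sup>2" by (simp add: of_nat_nat)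
    also have "\<dots> \<le> max 1 (1 / a\<^sup>2) * \<rho>\<^sup>2" by (intro mult_right_mono) auto
    finally have 2: "real (nat \<lfloor>\<rho>\<^sup>2\<rfloor>) \<le> max 1 (1 / a\<^sup>2) * \<rho>\<^sup>2" .
    have "s = 1 \<or> s \<le> nat \<lfloor>\<rho>\<^sup>2\<rfloor>" by (auto simp: s_def max_def min_def)
    then show ?thesis using 1 2 by (auto intro: order_trans)
  qed
  moreover have "\<rho>\<^sup>2 / ?D \<le> real s"
  proof -
    have D: "?D > 0" by simp
    consider "\<rho>\<^sup>2 < 1" | "1 \<le> \<rho>\<^sup>2" "n div 2 \<le> nat \<lfloor>\<rho>\<^sup>2\<rfloor>" | "1 \<le> \<rho>\<^sup>2" "nat \<lfloor>\<rho>\<^sup>2\<rfloor> \<le> n div 2"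
      by linarith
    then have "\<rho>\<^sup>2 \<le> real s * ?D"
    proof cases
      case 1
      have "1 * 1 \<le> real s * ?D" using \<open>1 \<le> s\<close> by (intro mult_mono) auto
      with 1 show ?thesis by simp
    next
      case 2
      \<comment> \<open>The worst case is \<open>n = 3\<close>, with equality.\<close>
      have "n \<le> 3 * (n div 2)" using n by presburger
      then have s: "real n \<le> 3 * real s" using 2 by (simp add: s_def)
      have "\<rho>\<^sup>2 \<le> (A * sqrt (real n))\<^sup>2" using a \<rho> by (intro power_mono) auto
      also have "\<dots> = A\<^sup>2 * real n" by (simp add: power_mult_distrib)
      also have "\<dots> \<le> A\<^sup>2 * (3 * real s)" using s by (intro mult_left_mono) auto
      also have "\<dots> = real s * (3 * A\<^sup>2)" by simp
      also have "\<dots> \<le> real s * ?D" by (intro mult_left_mono) auto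
      finally show ?thesis .
    next
      case 3
      have f: "\<lfloor>\<rho>\<^sup>2\<rfloor> \<ge> 1" using 3 by simp
      then have "real (nat \<lfloor>\<rho>\<^sup>2\<rfloor>) = of_int \<lfloor>\<rho>\<^sup>2\<rfloor>" by simp
      moreover have "\<rho>\<^sup>2 < of_int \<lfloor>\<rho>\<^sup>2\<rfloor> + 1" by linarith
      moreover have "(of_int \<lfloor>\<rho>\<^sup>2\<rfloor> :: real) \<ge> 1" using f by simp
      moreover have "real (nat \<lfloor>\<rho>\<^sup>2\<rfloor>) \<le> real s" using 3 by (simp add: s_def)
      ultimately have "\<rho>\<^sup>2 \<le> real s * 2" by linarith
      also have "\<dots> \<le> real s * ?D" by (intro mult_left_mono) auto
      finally show ?thesis .
    qed
    then show ?thesis using D by (simp add: pos_divide_le_eq)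
  qed
  ultimately show ?thesis by blast
qed

lemma threshold_necessary: threshold_necessary
  unfolding threshold_necessary_def
proof (intro allI impI)
  fix a A :: real
  assume a: "a > 0" and A: "A > 0"
  define c where "c = 1 / vol_bound * (1 / sqrt (max 2 (3 * A\<^sup>2)))"
  define C where "C = sqrt (max 1 (1 / a\<^sup>2))"
  \<comment> \<open>Distance at most \<open>D\<close> gives
    \<open>n / s \<le> 16 * D\<^sup>2 * m\<close> by the lower bound with constant 1 / 4; passing
    from \<open>s\<close> to the squared inradius costs \<open>vol_bound\<^sup>2\<close>.\<close>
  define \<eta> :: "real \<Rightarrow> real" where "\<eta> = (\<lambda>D. 1 / (16 * vol_bound\<^sup>2 * D\<^sup>2))"
  have vb: "vol_bound > 0" using vol_bound_ge_1 by linarith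
  have c0: "c > 0" by (simp add: c_def less_max_iff_disj)
  have C0: "C > 0" by (simp add: C_def less_max_iff_disj)
  have \<eta>: "\<eta> D > 0" if "D \<ge> 1" for D using that vb by (simp add: \<eta>_def)
  have main: "\<exists>K. isotropic n K \<and> symmetric n K \<and> c * \<rho> \<le> inradius n K \<and> inradius n K \<le> C * \<rho> \<and>
      (\<forall>D\<ge>1. \<forall>m\<ge>1. \<forall>U. (\<forall>j\<in>{1..m}. U j \<in> orthogonal_group n) \<and>
         geom_dist n (polar_average n m U K) (unit_ball n) \<le> D \<longrightarrow>
         real m \<ge> \<eta> D * (real n / (inradius n K)\<^sup>2))"
    if n: "2 \<le> n" and \<rho>: "a \<le> \<rho>" "\<rho> \<le> A * sqrt (real n)" for n \<rho>
  proof -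
    obtain s where adm: "admissible n s" and lo: "\<rho>\<^sup>2 / max 2 (3 * A\<^sup>2) \<le> real s"
      and hi: "real s \<le> max 1 (1 / a\<^sup>2) * \<rho>\<^sup>2"
      using admissible_sqrt_comparable[OF a A n \<rho>] by blast
    have s: "2 \<le> n" "1 \<le> s" "2 * s \<le> n" using admissible_le[OF adm] by auto
    note r = radius_bounds[OF adm]
    have \<rho>0: "\<rho> > 0" using a \<rho> by simp
    have "sqrt (\<rho>\<^sup>2 / max 2 (3 * A\<^sup>2)) \<le> sqrt (real s)" using lo by (rule real_sqrt_le_mono)
    then have "1 / vol_bound * (\<rho> / sqrt (max 2 (3 * A\<^sup>2))) \<le> 1 / vol_bound * sqrt (real s)"
      using vb \<rho>0 by (intro mult_left_mono) (simp_all add: real_sqrt_divide)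
    then have 1: "c * \<rho> \<le> radius_fst n s" using r(3) by (simp add: c_def)
    have "sqrt (real s) \<le> sqrt (max 1 (1 / a\<^sup>2) * \<rho>\<^sup>2)" using hi by (rule real_sqrt_le_mono)
    then have 2: "radius_fst n s \<le> C * \<rho>" using r(4) \<rho>0 by (simp add: C_def real_sqrt_mult)
    have 3: "real m \<ge> \<eta> D * (real n / (radius_fst n s)\<^sup>2)"
      if D: "D \<ge> 1" and m: "m \<ge> 1" and U: "\<forall>j\<in>{1..m}. U j \<in> orthogonal_group n"
        and le: "geom_dist n (polar_average n m U (K_body n s)) (unit_ball n) \<le> D" for D m U
    proof -
      have "1 / 4 * sqrt (real n / (real s * real m)) \<le> 1 / 4 * max 1 (sqrt (real n / (real s * real m)))"
        by simp
      also have "\<dots> \<le> D" using geom_dist_K_body_ge[OF adm m U] le by linarith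
      finally have "sqrt (real n / (real s * real m)) \<le> 4 * D" by simp
      then have "real n / (real s * real m) \<le> (4 * D)\<^sup>2" by (rule sqrt_le_D)
      then have nm: "real n / real s \<le> 16 * D\<^sup>2 * real m"
        using s m by (simp add: field_simps power_mult_distrib)
      have "(1 / vol_bound * sqrt (real s))\<^sup>2 \<le> (radius_fst n s)\<^sup>2"
        using r(3) vb by (intro power_mono) auto
      then have "real n / (radius_fst n s)\<^sup>2 \<le> real n / (1 / vol_bound * sqrt (real s))\<^sup>2"
        using r(1) vb s by (intro divide_left_mono mult_pos_pos zero_less_power) auto
      also have "\<dots> = vol_bound\<^sup>2 * (real n / real s)"
        by (simp only: power_mult_distrib power_divide) simp
      also have "\<dots> \<le> vol_bound\<^sup>2 * (16 * D\<^sup>2 * real m)"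
        using nm by (intro mult_left_mono) auto
      finally have "\<eta> D * (real n / (radius_fst n s)\<^sup>2) \<le> \<eta> D * (vol_bound\<^sup>2 * (16 * D\<^sup>2 * real m))"
        using \<eta>[OF D] by (intro mult_left_mono) auto
      also have "\<dots> = real m" using vb D unfolding \<eta>_def by (simp add: field_simps)
      finally show ?thesis .
    qed
    show ?thesis
      using isotropic_K_body[OF adm] symmetric_K_body[OF adm] 1 2 3
      by (intro exI[of _ "K_body n s"]) (auto simp: inradius_K_body[OF adm])
  qed
  then show "\<exists>c>0. \<exists>C>0. \<exists>\<eta> :: real \<Rightarrow> real. (\<forall>D\<ge>1. \<eta> D > 0) \<and>
        (\<forall>n\<ge>2. \<forall>\<rho>. a \<le> \<rho> \<and> \<rho> \<le> A * sqrt (real n) \<longrightarrow>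
           (\<exists>K. isotropic n K \<and> symmetric n K \<and>
                c * \<rho> \<le> inradius n K \<and> inradius n K \<le> C * \<rho> \<and>
                (\<forall>D\<ge>1. \<forall>m\<ge>1. \<forall>U. (\<forall>j\<in>{1..m}. U j \<in> orthogonal_group n) \<and>
                     geom_dist n (polar_average n m U K) (unit_ball n) \<le> D \<longrightarrow>
                     real m \<ge> \<eta> D * (real n / (inradius n K)\<^sup>2))))"
    using c0 C0 \<eta> by (intro exI[of _ c] exI[of _ C] exI[of _ \<eta>] conjI allI impI) auto
qed

theorem proposition6p3:
  shows
    "(\<forall>n s. admissible n s \<longrightarrow> symmetric n (K_body n s) \<and> isotropic n (K_body n s))
   \<and> (\<exists>c>0. \<exists>C>0. \<forall>n s. admissible n s \<longrightarrow>
        c * sqrt (real s) \<le> inradius n (K_body n s) \<and>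
        inradius n (K_body n s) \<le> C * sqrt (real s))
   \<and> (\<exists>c>0. \<exists>C>0. \<forall>n s. admissible n s \<longrightarrow>
        c * (1 / sqrt (real s)) \<le> gauge_max n (K_body n s) \<and>
        gauge_max n (K_body n s) \<le> C * (1 / sqrt (real s)))
   \<and> (\<exists>c>0. \<exists>C>0. \<forall>n s \<sigma>. admissible n s \<and> sphere_measure n \<sigma> \<longrightarrow>
        c * (1 / sqrt (real n)) \<le> gauge_mean n \<sigma> (K_body n s) \<and>
        gauge_mean n \<sigma> (K_body n s) \<le> C * (1 / sqrt (real n)))
   \<and> (\<exists>c>0. \<forall>n s m U. admissible n s \<and> 1 \<le> m \<and> (\<forall>j\<in>{1..m}. U j \<in> orthogonal_group n) \<longrightarrow>
        geom_dist n (polar_average n m U (K_body n s)) (unit_ball n)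
          \<ge> c * max 1 (sqrt (real n / (real s * real m))))
   \<and> (\<forall>k0. global_averaging_estimate k0 \<longrightarrow>
        (\<exists>c>0. \<exists>c1>0. \<exists>C1>0. \<forall>n s m \<mu>. admissible n s \<and> k0 \<le> m \<and> haar_orthogonal n \<mu> \<longrightarrow>
           holds_with_prob (haar_power m \<mu>) (1 - exp (- c * real n))
             (\<lambda>U. c1 * max 1 (sqrt (real n / (real s * real m)))
                    \<le> geom_dist n (polar_average n m U (K_body n s)) (unit_ball n) \<and>
                  geom_dist n (polar_average n m U (K_body n s)) (unit_ball n)
                    \<le> C1 * max 1 (sqrt (real n / (real s * real m)))))
        \<and> threshold_sufficient k0)
   \<and> threshold_necessary"
proof (intro conjI)
  show "\<forall>n s. admissible n s \<longrightarrow> symmetric n (K_body n s) \<and> isotropic n (K_body n s)"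
    by (simp add: symmetric_K_body isotropic_K_body)
  have vb: "vol_bound > 0" using vol_bound_ge_1 by linarith
  show "\<exists>c>0. \<exists>C>0. \<forall>n s. admissible n s \<longrightarrow>
      c * sqrt (real s) \<le> inradius n (K_body n s) \<and> inradius n (K_body n s) \<le> C * sqrt (real s)"
    using radius_bounds(3,4) vb
    by (intro exI[of _ "1 / vol_bound"] exI[of _ "1 :: real"] conjI allI impI) (auto simp: inradius_K_body)
  have "1 * (1 / sqrt (real s)) \<le> gauge_max n (K_body n s)
      \<and> gauge_max n (K_body n s) \<le> vol_bound * (1 / sqrt (real s))" if adm: "admissible n s" for n s
  proof
    note r = radius_bounds[OF adm]
    have s: "0 < sqrt (real s)" using admissible_le[OF adm] by simp
    show "1 * (1 / sqrt (real s)) \<le> gauge_max n (K_body n s)"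
      using r(1,4) s by (simp add: gauge_max_K_body[OF adm] frac_le)
    have "1 / radius_fst n s \<le> 1 / (1 / vol_bound * sqrt (real s))"
      using r(1,3) s vb by (intro divide_left_mono mult_pos_pos) auto
    then show "gauge_max n (K_body n s) \<le> vol_bound * (1 / sqrt (real s))"
      by (simp add: gauge_max_K_body[OF adm])
  qed
  then show "\<exists>c>0. \<exists>C>0. \<forall>n s. admissible n s \<longrightarrow>
      c * (1 / sqrt (real s)) \<le> gauge_max n (K_body n s) \<and>
      gauge_max n (K_body n s) \<le> C * (1 / sqrt (real s))"
    using vb zero_less_one by blast
  have "1 * (1 / sqrt (real n)) \<le> gauge_mean n \<sigma> (K_body n s)
      \<and> gauge_mean n \<sigma> (K_body n s) \<le> (3 * vol_bound) * (1 / sqrt (real n))"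
    if "admissible n s \<and> sphere_measure n \<sigma>" for n s \<sigma>
    using that gauge_mean_K_body[of n s \<sigma>] by (simp only: mult_1 simp_thms)
  moreover have "3 * vol_bound > 0" using vb by linarith
  ultimately show "\<exists>c>0. \<exists>C>0. \<forall>n s \<sigma>. admissible n s \<and> sphere_measure n \<sigma> \<longrightarrow>
      c * (1 / sqrt (real n)) \<le> gauge_mean n \<sigma> (K_body n s) \<and>
      gauge_mean n \<sigma> (K_body n s) \<le> C * (1 / sqrt (real n))"
    using zero_less_one by blast
  show "\<exists>c>0. \<forall>n s m U. admissible n s \<and> 1 \<le> m \<and> (\<forall>j\<in>{1..m}. U j \<in> orthogonal_group n) \<longrightarrow>
      geom_dist n (polar_average n m U (K_body n s)) (unit_ball n)
        \<ge> c * max 1 (sqrt (real n / (real s * real m)))"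
  proof (intro exI[of _ "1 / 4"] conjI allI impI)
    fix n s m :: nat and U
    assume "admissible n s \<and> 1 \<le> m \<and> (\<forall>j\<in>{1..m}. U j \<in> orthogonal_group n)"
    then show "1 / 4 * max 1 (sqrt (real n / (real s * real m)))
        \<le> geom_dist n (polar_average n m U (K_body n s)) (unit_ball n)"
      using geom_dist_K_body_ge by blast
  qed simp
  show "\<forall>k0. global_averaging_estimate k0 \<longrightarrow>
        (\<exists>c>0. \<exists>c1>0. \<exists>C1>0. \<forall>n s m \<mu>. admissible n s \<and> k0 \<le> m \<and> haar_orthogonal n \<mu> \<longrightarrow>
           holds_with_prob (haar_power m \<mu>) (1 - exp (- c * real n))
             (\<lambda>U. c1 * max 1 (sqrt (real n / (real s * real m)))
                    \<le> geom_dist n (polar_average n m U (K_body n s)) (unit_ball n) \<and>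
                  geom_dist n (polar_average n m U (K_body n s)) (unit_ball n)
                    \<le> C1 * max 1 (sqrt (real n / (real s * real m)))))
        \<and> threshold_sufficient k0"
  proof (intro allI impI conjI)
    fix k0
    assume est: "global_averaging_estimate k0"
    show "threshold_sufficient k0" using est by (rule threshold_sufficient_of_estimate)
    show "\<exists>c>0. \<exists>c1>0. \<exists>C1>0. \<forall>n s m \<mu>. admissible n s \<and> k0 \<le> m \<and> haar_orthogonal n \<mu> \<longrightarrow>
           holds_with_prob (haar_power m \<mu>) (1 - exp (- c * real n))
             (\<lambda>U. c1 * max 1 (sqrt (real n / (real s * real m)))
                    \<le> geom_dist n (polar_average n m U (K_body n s)) (unit_ball n) \<and>
                  geom_dist n (polar_average n m U (K_body n s)) (unit_ball n)
                    \<le> C1 * max 1 (sqrt (real n / (real s * real m))))"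
      using est by (rule averaging_two_sided)
  qed
  show threshold_necessary by (rule threshold_necessary)
qed

end
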